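(* Let $(\mathfrak{M},d)$ be a complete metric space, $1<p<\infty$, $\mathcal{E}:\mathfrak{M}\to(-\infty,+\infty]$ a proper functional with strong upper gradient $g$, and $v:[0,+\infty)\to\mathfrak{M}$ a $p$-gradient flow of $\mathcal{E}$ with non-empty $\omega$-limit set $\omega(v)$. Suppose that for some $\bar t>0$, $\mathcal{E}$ is lower semicontinuous on the closure of $\{v(t):t\ge\bar t\}$, and that for $\varphi\in\omega(v)$ with $g(\varphi)=0$ there are $\varepsilon,c>0$ and $\alpha\in(0,1]$ such that $\mathcal{E}$ satisfies the Łojasiewicz–Simon inequality with exponent $\alpha$ $$|\mathcal{E}(u|\varphi)|^{1-\alpha}\le c\,g(u)\qquad\text{for every } u\in B(\varphi,\varepsilon)\cap D(\mathcal{E}).$$ Then $$d(v(t),\varphi)\le\tfrac{c}{\alpha}\big(\mathcal{E}(v(t)|\varphi)\big)^{\alpha}=\mathcal{O}\Big(t^{-\frac{\alpha(p-1)}{1-p\alpha}}\Big)\qquad\text{if }0<\alpha<\tfrac1p,$$ $$d(v(t),\varphi)\le c\,p\,\big(\mathcal{E}(v(t)|\varphi)\big)^{\frac1p}\le c\,p\,\big(\mathcal{E}(v(t_0)|\varphi)\big)^{\frac1p}e^{-\frac{t}{p\,c^{p'}}}\qquad\text{if }\alpha=\tfrac1p,$$ $$d(v(t),\varphi)\le\begin{cases}\tilde c\,(\hat t-t)^{\frac{\alpha(p-1)}{p\alpha-1}}&\text{if }t_0\le t\le\hat t,\\0&\text{if }t>\hat t,\end{cases}\qquad\text{if }\tfrac1p<\alpha\le1,$$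 where $$\tilde c:=\Big[\Big[\tfrac{1}{\alpha^{\alpha-1}c}\Big]^{\frac{p'-1}{\alpha}}\tfrac{p\alpha-1}{\alpha(p-1)}\Big]^{\frac{\alpha(p-1)}{p\alpha-1}},\qquad \hat t:=t_0+\alpha^{\frac{\alpha-1}{\alpha(p-1)}}\,c^{\frac1{\alpha(p-1)}}\,\tfrac{\alpha(p-1)}{p\alpha-1}\,\big(\mathcal{E}(v(t_0)|\varphi)\big)^{\frac{p\alpha-1}{\alpha(p-1)}},$$ and $t_0\ge0$ can be chosen to be the "first entry time", that is, $t_0\ge0$ is the smallest time $\hat t_0\in[0,+\infty)$ such that $v([\hat t_0,+\infty))\subseteq B(\varphi,\varepsilon)$.
   Context: $p'=p/(p-1)$; $D(\mathcal{E})=\{\mathcal{E}<+\infty\}$; proper means $D(\mathcal{E})\ne\emptyset$; $\mathcal{E}(u|\varphi):=\mathcal{E}(u)-\mathcal{E}(\varphi)$; $B(\varphi,\varepsilon)$ is the open ball. $\omega(v)$ is the set of all $\psi$ for which there is $t_n\uparrow+\infty$ with $v(t_n)\to\psi$. $AC(a,b;\mathfrak{M})$ (resp. $AC_{loc}$): curves $v$ with $d(v(s),v(t))\le\int_s^tm(r)\,dr$ for all $a<s\le t<b$ and some $m\in L^1(a,b)$ (resp. $L^1_{loc}$); $|v'|(t)=\lim_{s\to t}d(v(s),v(t))/|s-t|$ (exists a.e.). A proper $g:\mathfrak{M}\to[0,+\infty]$ with $\{g<\infty\}\subseteq D(\mathcal{E})$ is a strong upper gradient of $\mathcal{E}$ if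 for every $v\in AC(a,b;\mathfrak{M})$, $g\circ v$ is Borel and $|\mathcal{E}(v(t))-\mathcal{E}(v(s))|\le\int_s^tg(v(r))|v'|(r)\,dr$ for $a<s\le t<b$. $v:[0,\infty)\to\mathfrak{M}$ is a $p$-gradient flow of $\mathcal{E}$ if $v\in AC_{loc}(0,\infty;\mathfrak{M})$, $\mathcal{E}\circ v:(0,\infty)\to\mathbb{R}$ is non-increasing and $\frac{d}{dt}\mathcal{E}(v(t))\le-\frac1{p'}g^{p'}(v(t))-\frac1p|v'|^p(t)$ for a.e. $t>0$.
   Formalization: Corrected: in t̂, (c/α)E(v(t0)|φ)^α replaces E(v(t0)|φ); the exponential has t−t0 for t; first entry time is an infimum; for t0=0, v must be right-continuous at 0 with E(v(0)) finite and E(v(t))≤E(v(0)); for α=1, 0^0 is read as 0. *)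

theory Defs
  imports "HOL-Analysis.Analysis" "HOL-Library.Landau_Symbols"
begin

definition conj_exp :: "real \<Rightarrow> real" where
  "conj_exp p = p / (p - 1)"

definition eff_domain :: "('a \<Rightarrow> ereal) \<Rightarrow> 'a set" where
  "eff_domain E = {u. E u < \<infinity>}"

definition proper_functional :: "('a \<Rightarrow> ereal) \<Rightarrow> bool" where
  "proper_functional E \<longleftrightarrow> (\<forall>u. E u \<noteq> -\<infinity>) \<and> eff_domain E \<noteq> {}"

text \<open>The relative energy; only meaningful for \<open>u\<close> and \<open>\<phi>\<close> in the effective domain.\<close>

definition rel_energy :: "('a \<Rightarrow> ereal) \<Rightarrow> 'a \<Rightarrow> 'a \<Rightarrow> real" where
  "rel_energy E u \<phi> = real_of_ereal (E u - E \<phi>)"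

text \<open>Lower semicontinuity of the restriction of \<open>E\<close> to \<open>S\<close>.\<close>

definition lsc_on :: "'a::topological_space set \<Rightarrow> ('a \<Rightarrow> ereal) \<Rightarrow> bool" where
  "lsc_on S E \<longleftrightarrow> (\<forall>x\<in>S. E x \<le> Liminf (at x within S) E)"

text \<open>
  A curve on an open interval with extended-real end points is a function on the reals of
  which only the values on \<open>einterval a b\<close> matter.
\<close>

definition AC :: "ereal \<Rightarrow> ereal \<Rightarrow> (real \<Rightarrow> 'a::metric_space) \<Rightarrow> bool" where
  "AC a b v \<longleftrightarrow> (\<exists>m::real \<Rightarrow> real. set_integrable lborel (einterval a b) m \<and>
     (\<forall>s t. a < ereal s \<and> s \<le> t \<and> ereal t < b \<longrightarrow>
        dist (v s) (v t) \<le> set_lebesgue_integral lborel {s..t} m))"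

definition AC_loc :: "ereal \<Rightarrow> ereal \<Rightarrow> (real \<Rightarrow> 'a::metric_space) \<Rightarrow> bool" where
  "AC_loc a b v \<longleftrightarrow> (\<exists>m::real \<Rightarrow> real.
     (\<forall>s t. a < ereal s \<and> s \<le> t \<and> ereal t < b \<longrightarrow> set_integrable lborel {s..t} m) \<and>
     (\<forall>s t. a < ereal s \<and> s \<le> t \<and> ereal t < b \<longrightarrow>
        dist (v s) (v t) \<le> set_lebesgue_integral lborel {s..t} m))"

text \<open>For (locally) absolutely continuous curves the limit exists at almost every \<open>t\<close>.\<close>

definition metric_deriv :: "(real \<Rightarrow> 'a::metric_space) \<Rightarrow> real \<Rightarrow> real" where
  "metric_deriv v t = Lim (at t) (\<lambda>s. dist (v s) (v t) / \<bar>s - t\<bar>)"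

text \<open>
  The inequality along \<open>v\<close> carries no information when the energy is infinite at both ends;
  that case is excluded because \<open>\<infinity> - \<infinity> = \<infinity>\<close> on \<^typ>\<open>ereal\<close>. If exactly one of
  the two energies is infinite, the integral has to be infinite.
\<close>

definition strong_upper_gradient ::
    "('a::metric_space \<Rightarrow> ereal) \<Rightarrow> ('a \<Rightarrow> ennreal) \<Rightarrow> bool" where
  "strong_upper_gradient E g \<longleftrightarrow>
     (\<exists>u. g u < \<infinity>) \<and> {u. g u < \<infinity>} \<subseteq> eff_domain E \<and>
     (\<forall>a b v. AC a b v \<longrightarrow>
        (\<lambda>t. g (v t)) \<in> borel_measurable (restrict_space borel (einterval a b)) \<and>
        (\<forall>s t. a < ereal s \<and> s \<le> t \<and> ereal t < b \<and> (E (v s) < \<infinity> \<or> E (v t) < \<infinity>) \<longrightarrow>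
           \<bar>E (v t) - E (v s)\<bar> \<le>
             enn2ereal (\<integral>\<^sup>+ r\<in>{s..t}. (g (v r) * ennreal (metric_deriv v r)) \<partial>lborel)))"

definition gradient_flow ::
    "real \<Rightarrow> ('a::metric_space \<Rightarrow> ereal) \<Rightarrow> ('a \<Rightarrow> ennreal) \<Rightarrow> (real \<Rightarrow> 'a) \<Rightarrow> bool" where
  "gradient_flow p E g v \<longleftrightarrow>
     AC_loc 0 \<infinity> v \<and>
     (\<forall>t>0. \<bar>E (v t)\<bar> \<noteq> \<infinity>) \<and>
     (\<forall>s t. 0 < s \<and> s \<le> t \<longrightarrow> E (v t) \<le> E (v s)) \<and>
     (AE t in lborel. 0 < t \<longrightarrow> g (v t) < \<infinity> \<and>
        (\<exists>D. ((\<lambda>s. real_of_ereal (E (v s))) has_real_derivative D) (at t) \<and>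
           D \<le> - (1 / conj_exp p) * enn2real (g (v t)) powr conj_exp p
               - (1 / p) * metric_deriv v t powr p))"

text \<open>
  Only the values on \<open>[0,\<infinity>)\<close> belong to a flow, and nothing in its definition
  relates \<open>v 0\<close> to the values at positive times. The following says that \<open>0\<close> may be
  used as a starting time just like any positive time.
\<close>

definition regular_at_zero :: "('a::metric_space \<Rightarrow> ereal) \<Rightarrow> (real \<Rightarrow> 'a) \<Rightarrow> bool" where
  "regular_at_zero E v \<longleftrightarrow>
     (v \<longlongrightarrow> v 0) (at_right 0) \<and> E (v 0) < \<infinity> \<and> (\<forall>t>0. E (v t) \<le> E (v 0))"

definition omega_limit :: "(real \<Rightarrow> 'a::metric_space) \<Rightarrow> 'a set" where
  "omega_limit v = {\<psi>. \<exists>t::nat \<Rightarrow> real. (\<forall>n. 0 \<le> t n) \<and> mono t \<and>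
     filterlim t at_top sequentially \<and> (\<lambda>n. v (t n)) \<longlonglongrightarrow> \<psi>}"

text \<open>
  For \<open>\<alpha> = 1\<close> the left-hand side is \<open>1\<close> where \<open>E u \<noteq> E \<phi>\<close> and \<open>0\<close> where
  \<open>E u = E \<phi>\<close>, since \<open>0 powr 0 = 0\<close>. Reading \<open>0\<^sup>0\<close> as \<open>1\<close> would contradict
  \<open>g \<phi> = 0\<close> at \<open>u = \<phi>\<close>.
\<close>

definition LS_inequality ::
    "('a::metric_space \<Rightarrow> ereal) \<Rightarrow> ('a \<Rightarrow> ennreal) \<Rightarrow> 'a \<Rightarrow> real \<Rightarrow> real \<Rightarrow> real \<Rightarrow> bool" where
  "LS_inequality E g \<phi> \<epsilon> c \<alpha> \<longleftrightarrow>
     (\<forall>u \<in> ball \<phi> \<epsilon> \<inter> eff_domain E.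
        ennreal (\<bar>rel_energy E u \<phi>\<bar> powr (1 - \<alpha>)) \<le> ennreal c * g u)"

definition entry_times :: "(real \<Rightarrow> 'a::metric_space) \<Rightarrow> 'a \<Rightarrow> real \<Rightarrow> real set" where
  "entry_times v \<phi> \<epsilon> = {s. 0 \<le> s \<and> v ` {s..} \<subseteq> ball \<phi> \<epsilon>}"

text \<open>
  An infimum, since a continuous curve entering the open ball from outside has no smallest
  entry time. It is the smallest entry time whenever there is one.
\<close>

definition first_entry_time :: "(real \<Rightarrow> 'a::metric_space) \<Rightarrow> 'a \<Rightarrow> real \<Rightarrow> real" where
  "first_entry_time v \<phi> \<epsilon> = Inf (entry_times v \<phi> \<epsilon>)"

definition decay_const :: "real \<Rightarrow> real \<Rightarrow> real \<Rightarrow> real" where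
  "decay_const p \<alpha> c =
     ((1 / (\<alpha> powr (\<alpha> - 1) * c)) powr ((conj_exp p - 1) / \<alpha>)
        * ((p * \<alpha> - 1) / (\<alpha> * (p - 1)))) powr (\<alpha> * (p - 1) / (p * \<alpha> - 1))"

text \<open>
  Here \<open>e\<close> is the relative energy of the flow at time \<open>t0\<close>. With
  \<open>H t = c / \<alpha> * rel_energy E (v t) \<phi> powr \<alpha>\<close> and
  \<open>K = (1 / (\<alpha> powr (\<alpha> - 1) * c)) powr (1 / (\<alpha> * (p - 1)))\<close>, the flow and
  the Lojasiewicz-Simon inequality give
  \<open>- H' \<ge> K * H powr ((1 - \<alpha>) / (\<alpha> * (p - 1)))\<close>. Integrating from \<open>t0\<close> bounds the
  extinction time in terms of \<open>H t0\<close>, so the base of the last power is \<open>H t0\<close> and not \<open>e\<close>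
  itself: with \<open>e\<close> there the bound fails, e.g. for the energy \<open>\<bar>x\<bar> / 2\<close> on the real
  line with \<open>p = 2\<close>, \<open>\<alpha> = 1\<close>, \<open>c = 2\<close>.
\<close>

definition extinction_time :: "real \<Rightarrow> real \<Rightarrow> real \<Rightarrow> real \<Rightarrow> real \<Rightarrow> real" where
  "extinction_time p \<alpha> c t0 e =
     t0 + \<alpha> powr ((\<alpha> - 1) / (\<alpha> * (p - 1))) * c powr (1 / (\<alpha> * (p - 1)))
        * (\<alpha> * (p - 1) / (p * \<alpha> - 1))
        * (c / \<alpha> * e powr \<alpha>) powr ((p * \<alpha> - 1) / (\<alpha> * (p - 1)))"

end

theory Submission
  imports Defs
begin

text \<open>
  Young's inequality bounds \<open>g(v) |v'|\<close> by \<open>- (E \<circ> v)'\<close>, and the upper gradient property gives the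
  reverse inequality after integration; hence \<open>- (E \<circ> v)' = g(v) |v'| = g(v)\<^sup>q = |v'|\<^sup>p\<close> almost
  everywhere, where \<open>q\<close> is the conjugate exponent of \<open>p\<close>. Let \<open>e\<close> be the relative energy along
  the flow. While the flow stays in the ball, the Lojasiewicz-Simon inequality makes
  \<open>H = c / \<alpha> * e\<^sup>\<alpha>\<close> satisfy \<open>|v'| \<le> - H'\<close>, so the length of the curve is controlled by the decrease
  of \<open>H\<close>. As \<open>H\<close> is monotone and bounded below, a curve that comes close to \<open>\<phi>\<close> late enough never
  leaves the ball again, and then \<open>d(v(t), \<phi>) \<le> H(t)\<close>. The rates follow by separating variables in
  \<open>- e' = g(v)\<^sup>q \<ge> (e powr (1 - \<alpha>) / c)\<^sup>q\<close>.

  Only derivatives of monotone functions have to be integrated, and for nondecreasing \<open>F\<close> Fatou's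
  lemma gives \<open>\<integral> F' \<le> F(t) - F(s)\<close>, which is the direction needed throughout. The existence of the metric derivative rests on
  Lebesgue's differentiation theorem, obtained from the Vitali covering theorem.
\<close>

subsection \<open>Differentiation of indefinite integrals\<close>

text \<open>The function H is dictated by the chain rule: c / \<alpha> * x powr \<alpha> has
  derivative c * x powr (\<alpha> - 1), so - H' = c * e powr (\<alpha> - 1) * g(v) |v'| where e is
  positive, and the Lojasiewicz-Simon inequality says precisely that the factor in front of |v'| is
  at least 1. This fixes the constant c / \<alpha> as well. Two obstacles shape the details. The
  derivative of the energy and the metric derivative exist only almost everywhere, while
  \<open>deriv\<close> and \<open>metric_deriv\<close> are arbitrary elsewhere; where measurability
  matters they are replaced by Borel functions that agree with them up to a null set. Moreover, a
  flow carries no information at time 0, so estimates that start there rest on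
  \<open>regular_at_zero\<close> and are reached from positive times by a limit or by
  monotonicity.\<close>

text \<open>Vitali selects, among the admissible intervals inside an outer neighbourhood
  \<open>U\<close>, a countable disjoint family covering \<open>A\<close> up to a Lebesgue null set.
  Summing the comparison over this family gives P A \<le> Q U, where absolute continuity of
  \<open>P\<close> discards the remainder. Both measures stay abstract because a multiple of
  Lebesgue measure will appear on either side.\<close>

lemma fine_cover_emeasure_le:
  fixes P Q :: "real measure"
  assumes P[measurable_cong]: "sets P = sets borel" and Q[measurable_cong]: "sets Q = sets borel"
    and ac: "absolutely_continuous lborel P"
    and A[measurable]: "A \<in> sets borel"
    and outer: "\<And>\<epsilon>. 0 < \<epsilon> \<Longrightarrow> \<exists>U. open U \<and> A \<subseteq> U \<and> emeasure Q U \<le> emeasure Q A + ennreal \<epsilon>"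
    and fine: "\<And>x d. \<lbrakk>x \<in> A; 0 < d\<rbrakk> \<Longrightarrow>
      \<exists>a b. a < x \<and> x < b \<and> b - a < d \<and> emeasure P {a<..<b} \<le> emeasure Q {a<..<b}"
  shows "emeasure P A \<le> emeasure Q A"
proof (rule ennreal_le_epsilon)
  fix \<epsilon> :: real assume "0 < \<epsilon>"
  then obtain U where U: "open U" "A \<subseteq> U" "emeasure Q U \<le> emeasure Q A + ennreal \<epsilon>"
    using outer by blast
  define I where "I = (\<lambda>(a, b). {a<..<b::real})"
  define K where "K = {i. I i \<subseteq> U \<and> emeasure P (I i) \<le> emeasure Q (I i)}"
  \<comment> \<open>The covering theorem speaks of balls containing x. An interval is the ball
    around its midpoint, so x need not be the centre.\<close>
  have ball_I: "ball ((fst i + snd i) / 2) ((snd i - fst i) / 2) = I i" for i :: "real \<times> real"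
    by (auto simp: ball_eq_greaterThanLessThan I_def case_prod_beta field_simps)
  have "\<exists>i. i \<in> K \<and> x \<in> ball ((fst i + snd i) / 2) ((snd i - fst i) / 2) \<and> (snd i - fst i) / 2 < d"
    if x: "x \<in> A" and d: "0 < d" for x d
  proof -
    obtain e where e: "e > 0" "ball x e \<subseteq> U"
      using U x by (meson open_contains_ball subsetD)
    obtain a b where ab: "a < x" "x < b" "b - a < min d e"
      "emeasure P {a<..<b} \<le> emeasure Q {a<..<b}"
      using fine[OF x, of "min d e"] d e by auto
    have "I (a, b) \<subseteq> U"
    proof
      fix y assume "y \<in> I (a, b)"
      with ab have "y \<in> ball x e" by (auto simp: I_def dist_real_def)
      with e show "y \<in> U" by auto
    qed
    then show ?thesis
      using ab unfolding ball_I by (intro exI[of _ "(a, b)"]) (auto simp: K_def I_def)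
  qed
  from Vitali_covering_theorem_balls[of A K "\<lambda>i. (fst i + snd i) / 2" "\<lambda>i. (snd i - fst i) / 2", OF this]
  obtain C where C: "countable C" "C \<subseteq> K" "pairwise (\<lambda>i j. disjnt (I i) (I j)) C"
    "negligible (A - (\<Union>i\<in>C. I i))"
    unfolding ball_I by metis
  have I[measurable]: "I i \<in> sets borel" for i
    by (auto simp: I_def case_prod_beta)
  have UN[measurable]: "(\<Union>i\<in>C. I i) \<in> sets borel"
    using C(1) by (intro sets.countable_UN') auto
  have disj: "disjoint_family_on I C"
    using C(3) by (auto simp: disjoint_family_on_def pairwise_def disjnt_def)
  have "A - (\<Union>i\<in>C. I i) \<in> null_sets lborel"
    using C(4) by (simp add: negligible_iff_null_sets null_sets_completion_iff)
  then have null: "A - (\<Union>i\<in>C. I i) \<in> null_sets P"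
    using ac by (auto simp: absolutely_continuous_def)
  have "emeasure P A \<le> emeasure P ((\<Union>i\<in>C. I i) \<union> (A - (\<Union>i\<in>C. I i)))"
    by (intro emeasure_mono) auto
  also have "\<dots> = emeasure P (\<Union>i\<in>C. I i)"
    using null by (intro emeasure_Un_null_set) auto
  also have "\<dots> = (\<integral>\<^sup>+i. emeasure P (I i) \<partial>count_space C)"
    using C disj by (intro emeasure_UN_countable) auto
  also have "\<dots> \<le> (\<integral>\<^sup>+i. emeasure Q (I i) \<partial>count_space C)"
    using C(2) by (intro nn_integral_mono) (auto simp: K_def)
  also have "\<dots> = emeasure Q (\<Union>i\<in>C. I i)"
    using C disj by (intro emeasure_UN_countable[symmetric]) auto
  also have "\<dots> \<le> emeasure Q U"
    using C(2) U(1) by (intro emeasure_mono) (auto simp: K_def)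
  also note U(3)
  finally show "emeasure P A \<le> emeasure Q A + ennreal \<epsilon>" .
qed

lemma continuous_indefinite_integral:
  fixes f :: "real \<Rightarrow> real"
  assumes f: "integrable lborel f"
  shows "isCont (\<lambda>s. LINT x:{..s}|lborel. f x) t"
  unfolding continuous_at_sequentially comp_def
proof (intro allI impI)
  fix u :: "nat \<Rightarrow> real" assume u: "u \<longlonglongrightarrow> t"
  show "(\<lambda>n. LINT x:{..u n}|lborel. f x) \<longlonglongrightarrow> (LINT x:{..t}|lborel. f x)"
    unfolding set_lebesgue_integral_def
  proof (rule integral_dominated_convergence[where w = "\<lambda>x. norm (f x)"])
    have "AE x in lborel. x \<noteq> t"
      by (rule AE_lborel_singleton)
    then show "AE x in lborel. (\<lambda>n. indicator {..u n} x *\<^sub>R f x) \<longlonglongrightarrow> indicator {..t} x *\<^sub>R f x"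
    proof eventually_elim
      case (elim x)
      have "\<forall>\<^sub>F n in sequentially. indicator {..u n} x *\<^sub>R f x = indicator {..t} x *\<^sub>R f x"
      proof (cases "x < t")
        case True
        from order_tendstoD(1)[OF u this] show ?thesis
          by eventually_elim (use True in auto)
      next
        case False
        with elim have "t < x" by auto
        from order_tendstoD(2)[OF u this] show ?thesis
          by eventually_elim (use \<open>t < x\<close> in auto)
      qed
      then show ?case by (rule tendsto_eventually)
    qed
  qed (use f in \<open>auto simp: indicator_def\<close>)
qed

lemma indefinite_integral_diff:
  fixes f :: "real \<Rightarrow> real"
  assumes f: "integrable lborel f" and "a \<le> b"
  shows "(LINT x:{..b}|lborel. f x) - (LINT x:{..a}|lborel. f x) = (LINT x:{a..b}|lborel. f x)"
proof -
  have "(LINT x:{..b}|lborel. f x) = (LINT x:{..a} \<union> {a<..b}|lborel. f x)"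
    using assms by (simp add: ivl_disj_un_one)
  also have "\<dots> = (LINT x:{..a}|lborel. f x) + (LINT x:{a<..b}|lborel. f x)"
    by (intro set_integral_Un) (auto simp: set_integrable_def intro!: integrable_real_mult_indicator f simp: mult.commute)
  also have "(LINT x:{a<..b}|lborel. f x) = (LINT x:{a..b}|lborel. f x)"
    using AE_lborel_singleton[of a] f
    unfolding set_lebesgue_integral_def
    by (intro integral_cong_AE) (auto elim!: eventually_mono simp: indicator_def)
  finally show ?thesis by simp
qed

lemma emeasure_density_interval:
  fixes f :: "real \<Rightarrow> real"
  assumes f: "integrable lborel f" "\<And>x. 0 \<le> f x" and "a \<le> b"
  shows "emeasure (density lborel f) {a<..<b} =
    ennreal ((LINT x:{..b}|lborel. f x) - (LINT x:{..a}|lborel. f x))"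
proof -
  have "emeasure (density lborel f) {a<..<b} = (\<integral>\<^sup>+x. ennreal (f x) * indicator {a<..<b} x \<partial>lborel)"
    using f by (intro emeasure_density) auto
  also have "\<dots> = (\<integral>\<^sup>+x. ennreal (indicator {a..b} x * f x) \<partial>lborel)"
    using AE_lborel_singleton[of a] AE_lborel_singleton[of b]
    by (intro nn_integral_cong_AE) (auto elim!: eventually_elim2 simp: indicator_def)
  also have "\<dots> = ennreal (LINT x:{a..b}|lborel. f x)"
    unfolding set_lebesgue_integral_def
    using f by (subst nn_integral_eq_integral) (auto intro!: integrable_real_mult_indicator simp: mult.commute)
  finally show ?thesis
    using assms by (simp add: indefinite_integral_diff)
qed

lemma emeasure_density_const_interval:
  "0 \<le> q \<Longrightarrow> a \<le> b \<Longrightarrow> emeasure (density lborel (\<lambda>_. ennreal q)) {a<..<b} = ennreal (q * (b - a))"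
  by (simp add: emeasure_density_const ennreal_mult'')

text \<open>A positive multiple of Lebesgue measure has infinite total mass, so the regularity of
  finite measures that serves \<open>outer_regular_density\<close> does not apply; regularity of
  Lebesgue measure is rescaled instead.\<close>

lemma outer_regular_scale_lborel:
  fixes A :: "real set"
  assumes "A \<in> sets borel" "0 \<le> q" "0 < \<epsilon>"
  shows "\<exists>U. open U \<and> A \<subseteq> U \<and>
    emeasure (density lborel (\<lambda>_. ennreal q)) U \<le> emeasure (density lborel (\<lambda>_. ennreal q)) A + ennreal \<epsilon>"
proof -
  \<comment> \<open>Dividing by q + 1 rather than by q keeps the tolerance meaningful when q =
    0.\<close>
  obtain U where U: "open U" "A \<subseteq> U" "emeasure lborel (U - A) < ennreal (\<epsilon> / (q + 1))"
    using outer_regular_lborel[of A "\<epsilon> / (q + 1)"] assms by auto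
  have "emeasure lborel U = emeasure lborel A + emeasure lborel (U - A)"
    using U assms by (subst plus_emeasure) (auto simp: Un_absorb1)
  moreover have "ennreal q * emeasure lborel (U - A) \<le> ennreal q * ennreal (\<epsilon> / (q + 1))"
    using U by (intro mult_left_mono) auto
  moreover have "q * (\<epsilon> / (q + 1)) \<le> \<epsilon>"
    using assms by (simp add: field_simps)
  ultimately have "ennreal q * emeasure lborel U \<le> ennreal q * emeasure lborel A + ennreal \<epsilon>"
    using assms by (simp add: distrib_left ennreal_mult[symmetric])
      (meson add_left_mono ennreal_leI order_trans)
  then show ?thesis
    using U assms by (intro exI[of _ U]) (simp add: emeasure_density_const)
qed

lemma outer_regular_density:
  fixes f :: "real \<Rightarrow> real"
  assumes f: "integrable lborel f" "\<And>x. 0 \<le> f x" and "A \<in> sets borel" "0 < \<epsilon>"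
  shows "\<exists>U. open U \<and> A \<subseteq> U \<and>
    emeasure (density lborel f) U \<le> emeasure (density lborel f) A + ennreal \<epsilon>"
proof -
  have fin: "emeasure (density lborel f) UNIV \<noteq> \<infinity>"
    using f by (subst emeasure_density) (auto simp: nn_integral_eq_integral)
  have eq: "emeasure (density lborel f) A = (INF U\<in>{U. A \<subseteq> U \<and> open U}. emeasure (density lborel f) U)"
    using assms fin by (intro outer_regular) auto
  have "emeasure (density lborel f) A \<noteq> \<infinity>"
    using fin emeasure_mono[of A UNIV "density lborel f"] by (auto simp: top_unique)
  then have "(INF U\<in>{U. A \<subseteq> U \<and> open U}. emeasure (density lborel f) U)
      < emeasure (density lborel f) A + ennreal \<epsilon>"
    unfolding eq[symmetric] using \<open>0 < \<epsilon>\<close> by (simp add: ennreal_add_left_cancel_less less_top)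
  then show ?thesis
    by (auto simp: INF_less_iff intro: less_imp_le)
qed


text \<open>Finiteness excludes the case in which both sides are infinite. It is phrased for the
  scaled measure because that is what the finite mass of a density bounds.\<close>

lemma lborel_null_if_scaled_le:
  assumes "A \<in> sets borel" "0 \<le> p" "p < q"
    and le: "ennreal q * emeasure lborel A \<le> ennreal p * emeasure lborel A"
    and fin: "ennreal q * emeasure lborel A < \<infinity>"
  shows "A \<in> null_sets lborel"
proof -
  have "emeasure lborel A \<noteq> \<infinity>"
    using fin assms by (auto simp: ennreal_mult_eq_top_iff less_top[symmetric])
  then obtain l where l: "emeasure lborel A = ennreal l" "0 \<le> l"
    by (cases "emeasure lborel A") auto
  with le assms have "q * l \<le> p * l"
    by (simp add: ennreal_mult[symmetric])
  with l assms have "l = 0"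
    by (simp add: mult_le_cancel_right)
  with l assms show ?thesis by (auto simp: null_sets_def)
qed

text \<open>The covering argument controls only intervals with \<open>x\<close> strictly inside,
  whereas a difference quotient at \<open>x\<close> has \<open>x\<close> as an end point. Widening
  both ends by \<open>h\<close> and letting \<open>h\<close> tend to 0 closes this gap; the strict b
  - a < d leaves room for \<open>h\<close>.\<close>

lemma secant_bound_closed:
  fixes F :: "real \<Rightarrow> real"
  assumes cont: "\<And>t. isCont F t"
    and bound: "\<And>a b. \<lbrakk>a < x; x < b; b - a < d\<rbrakk> \<Longrightarrow> F b - F a \<le> q * (b - a)"
    and ab: "a \<le> x" "x \<le> b" "b - a < d"
  shows "F b - F a \<le> q * (b - a)"
proof (rule tendsto_le)
  show "((\<lambda>h. q * ((b + h) - (a - h))) \<longlongrightarrow> q * (b - a)) (at_right 0)"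
    by (auto intro!: tendsto_eq_intros)
  have "((\<lambda>h. F (b + h)) \<longlongrightarrow> F b) (at_right 0)"
    by (rule isCont_tendsto_compose[OF cont]) (auto intro!: tendsto_eq_intros)
  moreover have "((\<lambda>h. F (a - h)) \<longlongrightarrow> F a) (at_right 0)"
    by (rule isCont_tendsto_compose[OF cont]) (auto intro!: tendsto_eq_intros)
  ultimately show "((\<lambda>h. F (b + h) - F (a - h)) \<longlongrightarrow> F b - F a) (at_right 0)"
    by (rule tendsto_diff)
  have "\<forall>\<^sub>F h in at_right 0. 0 < h \<and> h < (d - (b - a)) / 2"
    using ab by (auto simp: eventually_at_right_field intro!: exI[of _ "(d - (b - a)) / 2"])
  then show "\<forall>\<^sub>F h in at_right 0. F (b + h) - F (a - h) \<le> q * ((b + h) - (a - h))"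
    by eventually_elim (rule bound, use ab in auto)
qed simp

text \<open>At each scale 1 / (n + 1) the points covered form a union of open intervals, so the set
  is a G-delta whatever \<open>R\<close> is.\<close>

lemma borel_fine_cover_set:
  "{x::real. \<forall>d>0. \<exists>a b. a < x \<and> x < b \<and> b - a < d \<and> R a b} \<in> sets borel"
proof -
  define U where "U n = \<Union>{{a<..<b} | a b. b - a < inverse (real (Suc n)) \<and> R a b}" for n
  have "open (U n)" for n
    unfolding U_def by (intro open_Union) auto
  then have "(\<Inter>n. U n) \<in> sets borel" by auto
  also have "(\<Inter>n. U n) = {x. \<forall>d>0. \<exists>a b. a < x \<and> x < b \<and> b - a < d \<and> R a b}"
  proof safe
    fix x d assume x: "x \<in> (\<Inter>n. U n)" and "0 < (d::real)"
    then obtain n where n: "inverse (real (Suc n)) < d"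
      using reals_Archimedean by blast
    from x have "x \<in> U n" by blast
    then obtain a b where "x \<in> {a<..<b}" "b - a < inverse (real (Suc n))" "R a b"
      unfolding U_def by blast
    with n show "\<exists>a b. a < x \<and> x < b \<and> b - a < d \<and> R a b"
      by (intro exI[of _ a] exI[of _ b]) auto
  next
    fix x n assume *: "\<forall>d>0. \<exists>a b. a < x \<and> x < b \<and> b - a < d \<and> R a b"
    have "0 < inverse (real (Suc n))" by simp
    with * obtain a b where "a < x" "x < b" "b - a < inverse (real (Suc n))" "R a b"
      by blast
    then have "x \<in> {a<..<b}" "{a<..<b} \<in> {{a<..<b} | a b. b - a < inverse (real (Suc n)) \<and> R a b}"
      by auto
    then show "x \<in> U n" unfolding U_def by blast
  qed
  finally show ?thesis .
qed

section \<open>Lebesgue's differentiation theorem\<close>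

text \<open>Where the derivative fails to be \<open>f x\<close>, two rationals separate
  \<open>f x\<close> from secant slopes around \<open>x\<close> at arbitrarily small scales. On the
  set where f \<le> p < q but slopes reach q, the covering lemma bounds q times the measure by the
  integral of \<open>f\<close>, hence by p times the measure, so the set is null. The opposite case
  is symmetric.\<close>

lemma AE_DERIV_indefinite_integral_nonneg:
  fixes f :: "real \<Rightarrow> real"
  assumes f: "integrable lborel f" "\<And>x. 0 \<le> f x"
  shows "AE x in lborel. ((\<lambda>s. LINT y:{..s}|lborel. f y) has_real_derivative f x) (at x)"
proof -
  define F where "F s = (LINT y:{..s}|lborel. f y)" for s
  have cont: "isCont F t" for t
    unfolding F_def by (rule continuous_indefinite_integral[OF f(1)])
  have F_diff: "F b - F a = (LINT y:{a..b}|lborel. f y)" if "a \<le> b" for a b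
    unfolding F_def using f(1) that by (rule indefinite_integral_diff)
  have mono: "F a \<le> F b" if "a \<le> b" for a b
  proof -
    have "0 \<le> F b - F a"
      unfolding F_diff[OF that] set_lebesgue_integral_def
      using f(2) by (intro integral_nonneg_AE) (auto simp: indicator_def)
    then show ?thesis by simp
  qed
  have N_ivl: "emeasure (density lborel f) {a<..<b} = ennreal (F b - F a)" if "a \<le> b" for a b
    unfolding F_def using f that by (rule emeasure_density_interval)
  have [measurable]: "f \<in> borel_measurable borel"
    using f(1) by auto
  define steep where "steep q = {x. \<forall>d>0. \<exists>a b. a < x \<and> x < b \<and> b - a < d \<and> q * (b - a) \<le> F b - F a}" for q
  define flat where "flat q = {x. \<forall>d>0. \<exists>a b. a < x \<and> x < b \<and> b - a < d \<and> F b - F a \<le> q * (b - a)}" for q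
  have [measurable]: "steep q \<in> sets borel" "flat q \<in> sets borel" for q
    unfolding steep_def flat_def by (rule borel_fine_cover_set)+
  have fin: "emeasure (density lborel f) A < \<infinity>" if "A \<in> sets borel" for A
  proof -
    have "emeasure (density lborel f) A \<le> emeasure (density lborel f) UNIV"
      by (intro emeasure_mono) auto
    also have "\<dots> < \<infinity>"
      using f by (subst emeasure_density) (auto simp: nn_integral_eq_integral)
    finally show ?thesis .
  qed
  have N_le: "emeasure (density lborel f) A \<le> ennreal p * emeasure lborel A"
    if "A \<in> sets borel" "\<And>x. x \<in> A \<Longrightarrow> f x \<le> p" for A p
  proof -
    have "emeasure (density lborel f) A \<le> emeasure (density lborel (\<lambda>_. ennreal p)) A"
      using that
      by (auto simp: emeasure_density indicator_def simp del: emeasure_density_const nn_integral_cmult_indicator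
          intro!: nn_integral_mono ennreal_leI)
    then show ?thesis using that by (simp add: emeasure_density_const)
  qed
  have N_ge: "ennreal p * emeasure lborel A \<le> emeasure (density lborel f) A"
    if "A \<in> sets borel" "\<And>x. x \<in> A \<Longrightarrow> p \<le> f x" for A p
  proof -
    have "emeasure (density lborel (\<lambda>_. ennreal p)) A \<le> emeasure (density lborel f) A"
      using that
      by (auto simp: emeasure_density indicator_def simp del: emeasure_density_const nn_integral_cmult_indicator
          intro!: nn_integral_mono ennreal_leI)
    then show ?thesis using that by (simp add: emeasure_density_const)
  qed
  have ac: "absolutely_continuous lborel (density lborel (\<lambda>x. ennreal (h x)))"
    if "h \<in> borel_measurable borel" for h :: "real \<Rightarrow> real"
    using that by (intro absolutely_continuousI_density) auto
  have null_steep: "{x. f x \<le> p} \<inter> steep q \<in> null_sets lborel" if "0 \<le> p" "p < q" for p q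
  proof -
    let ?A = "{x. f x \<le> p} \<inter> steep q"
    have A: "?A \<in> sets borel" by measurable
    have "emeasure (density lborel (\<lambda>_. ennreal q)) ?A \<le> emeasure (density lborel f) ?A"
    proof (rule fine_cover_emeasure_le)
      show "\<exists>a b. a < x \<and> x < b \<and> b - a < d \<and>
          emeasure (density lborel (\<lambda>_. ennreal q)) {a<..<b} \<le> emeasure (density lborel f) {a<..<b}"
        if "x \<in> ?A" "0 < d" for x d
      proof -
        from that obtain a b where "a < x" "x < b" "b - a < d" "q * (b - a) \<le> F b - F a"
          unfolding steep_def by blast
        then show ?thesis
          using \<open>0 \<le> p\<close> \<open>p < q\<close>
          by (intro exI[of _ a] exI[of _ b]) (auto simp: emeasure_density_const_interval N_ivl intro!: ennreal_leI)
      qed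
    qed (use A f ac outer_regular_density in auto)
    then have "ennreal q * emeasure lborel ?A \<le> emeasure (density lborel f) ?A"
      using A by (simp add: emeasure_density_const)
    moreover note N_le[OF A, of p] fin[OF A]
    ultimately show ?thesis
      using that A by (intro lborel_null_if_scaled_le[of _ p q]) auto
  qed
  have null_flat: "{x. q \<le> f x} \<inter> flat p \<in> null_sets lborel" if "0 \<le> p" "p < q" for p q
  proof -
    let ?A = "{x. q \<le> f x} \<inter> flat p"
    have A: "?A \<in> sets borel" by measurable
    have "emeasure (density lborel f) ?A \<le> emeasure (density lborel (\<lambda>_. ennreal p)) ?A"
    proof (rule fine_cover_emeasure_le)
      show "\<exists>a b. a < x \<and> x < b \<and> b - a < d \<and>
          emeasure (density lborel f) {a<..<b} \<le> emeasure (density lborel (\<lambda>_. ennreal p)) {a<..<b}"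
        if "x \<in> ?A" "0 < d" for x d
      proof -
        from that obtain a b where "a < x" "x < b" "b - a < d" "F b - F a \<le> p * (b - a)"
          unfolding flat_def by blast
        then show ?thesis
          using \<open>0 \<le> p\<close> \<open>p < q\<close>
          by (intro exI[of _ a] exI[of _ b]) (auto simp: emeasure_density_const_interval N_ivl intro!: ennreal_leI)
      qed
    qed (use A that ac outer_regular_scale_lborel in auto)
    then have "emeasure (density lborel f) ?A \<le> ennreal p * emeasure lborel ?A"
      using A by (simp add: emeasure_density_const)
    moreover note N_ge[OF A, of q] fin[OF A]
    ultimately show ?thesis
      using that A by (intro lborel_null_if_scaled_le[of _ p q]) (auto intro: order_trans le_less_trans)
  qed
  define R where "R = {(p, q). p \<in> \<rat> \<and> q \<in> \<rat> \<and> 0 \<le> p \<and> p < (q::real)}"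
  have "countable R"
    by (rule countable_subset[of _ "\<rat> \<times> \<rat>"]) (auto simp: R_def countable_rat)
  have "AE x in lborel. \<forall>(p, q)\<in>R.
      x \<notin> {x. f x \<le> p} \<inter> steep q \<and> x \<notin> {x. q \<le> f x} \<inter> flat p"
    unfolding case_prod_beta using \<open>countable R\<close>
    by (subst AE_ball_countable) (auto simp: R_def intro!: AE_conjI AE_not_in null_steep null_flat
        simp del: Int_iff mem_Collect_eq)
  then show ?thesis
  proof eventually_elim
    case (elim x)
    have upper: "\<exists>d>0. \<forall>a b. a \<le> x \<and> x \<le> b \<and> b - a < d \<longrightarrow> F b - F a \<le> (f x + e) * (b - a)"
      if "0 < e" for e
    proof -
      obtain p where p: "p \<in> \<rat>" "f x < p" "p < f x + e"
        using Rats_dense_in_real[of "f x" "f x + e"] \<open>0 < e\<close> by auto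
      obtain q where q: "q \<in> \<rat>" "p < q" "q < f x + e"
        using Rats_dense_in_real[of p "f x + e"] p by auto
      have "(p, q) \<in> R" using p q f(2)[of x] by (auto simp: R_def)
      with elim p have "x \<notin> steep q" by auto
      then obtain d where d: "0 < d" "\<And>a b. \<lbrakk>a < x; x < b; b - a < d\<rbrakk> \<Longrightarrow> \<not> q * (b - a) \<le> F b - F a"
        unfolding steep_def by blast
      have "F b - F a \<le> (f x + e) * (b - a)" if "a \<le> x" "x \<le> b" "b - a < d" for a b
      proof -
        have "F b - F a \<le> q * (b - a)"
          by (rule secant_bound_closed[OF cont _ that]) (use d in force)
        also have "\<dots> \<le> (f x + e) * (b - a)"
          using q that by (intro mult_right_mono) auto
        finally show ?thesis .
      qed
      then show ?thesis using d(1) by blast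
    qed
    have lower: "\<exists>d>0. \<forall>a b. a \<le> x \<and> x \<le> b \<and> b - a < d \<longrightarrow> (f x - e) * (b - a) \<le> F b - F a"
      if "0 < e" for e
    \<comment> \<open>Pairs in \<open>R\<close> have p \<ge> 0 and say nothing about negative
      slopes; for those, monotonicity of \<open>F\<close> suffices.\<close>
    proof (cases "f x - e \<le> 0")
      case True
      then show ?thesis
        using mono by (intro exI[of _ 1]) (auto intro: order_trans[OF mult_nonpos_nonneg])
    next
      case False
      obtain p where p: "p \<in> \<rat>" "f x - e < p" "p < f x"
        using Rats_dense_in_real[of "f x - e" "f x"] \<open>0 < e\<close> by auto
      obtain q where q: "q \<in> \<rat>" "p < q" "q < f x"
        using Rats_dense_in_real[of p "f x"] p by auto
      have "(p, q) \<in> R" using p q False by (auto simp: R_def)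
      with elim q have "x \<notin> flat p" by auto
      then obtain d where d: "0 < d" "\<And>a b. \<lbrakk>a < x; x < b; b - a < d\<rbrakk> \<Longrightarrow> \<not> F b - F a \<le> p * (b - a)"
        unfolding flat_def by blast
      have "(f x - e) * (b - a) \<le> F b - F a" if "a \<le> x" "x \<le> b" "b - a < d" for a b
      proof -
        have "(- F b) - (- F a) \<le> (- p) * (b - a)"
          by (rule secant_bound_closed[OF _ _ that]) (use d cont in \<open>force intro: continuous_minus\<close>)+
        moreover have "(f x - e) * (b - a) \<le> p * (b - a)"
          using p that by (intro mult_right_mono) auto
        ultimately show ?thesis by simp
      qed
      then show ?thesis using d(1) by blast
    qed
    have "(F has_real_derivative f x) (at x)"
      unfolding has_field_derivative_iff Lim_at
    proof (intro allI impI)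
      fix e :: real assume "0 < e"
      then obtain d1 d2 where d: "d1 > 0" "d2 > 0"
        and d1: "\<And>a b. a \<le> x \<Longrightarrow> x \<le> b \<Longrightarrow> b - a < d1 \<Longrightarrow> F b - F a \<le> (f x + e / 2) * (b - a)"
        and d2: "\<And>a b. a \<le> x \<Longrightarrow> x \<le> b \<Longrightarrow> b - a < d2 \<Longrightarrow> (f x - e / 2) * (b - a) \<le> F b - F a"
        using upper[of "e / 2"] lower[of "e / 2"] by auto
      have secant: "\<bar>(F b - F a) / (b - a) - f x\<bar> \<le> e / 2"
        if "a \<le> x" "x \<le> b" "a < b" "b - a < min d1 d2" for a b
      proof -
        have "(F b - F a) / (b - a) \<le> f x + e / 2" "f x - e / 2 \<le> (F b - F a) / (b - a)"
          using that d1[of a b] d2[of a b] by (simp_all add: pos_divide_le_eq pos_le_divide_eq)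
        then show ?thesis by linarith
      qed
      have "dist ((F y - F x) / (y - x)) (f x) < e" if y: "0 < dist y x" "dist y x < min d1 d2" for y
      proof -
        have "(F x - F y) / (x - y) = (F y - F x) / (y - x)"
          by (metis minus_diff_eq minus_divide_divide)
        then have "\<bar>(F y - F x) / (y - x) - f x\<bar> \<le> e / 2"
          using secant[of x y] secant[of y x] y by (cases "x < y") (auto simp: dist_real_def)
        with \<open>0 < e\<close> show ?thesis by (simp add: dist_real_def)
      qed
      with d show "\<exists>d>0. \<forall>y. 0 < dist y x \<and> dist y x < d \<longrightarrow> dist ((F y - F x) / (y - x)) (f x) < e"
        by (intro exI[of _ "min d1 d2"]) auto
    qed
    then show ?case by (simp add: F_def[abs_def])
  qed
qed

lemma integrable_imp_set_integrable:
  fixes f :: "'a \<Rightarrow> real"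
  shows "integrable M f \<Longrightarrow> A \<in> sets M \<Longrightarrow> set_integrable M A f"
  by (auto simp: set_integrable_def mult.commute intro!: integrable_real_mult_indicator)

lemma AE_DERIV_indefinite_integral:
  fixes f :: "real \<Rightarrow> real"
  assumes f: "integrable lborel f"
  shows "AE x in lborel. ((\<lambda>s. LINT y:{..s}|lborel. f y) has_real_derivative f x) (at x)"
proof -
  define g where "g x = max 0 (f x)" for x
  define h where "h x = max 0 (- f x)" for x
  have gh: "integrable lborel g" "integrable lborel h" "\<And>x. 0 \<le> g x" "\<And>x. 0 \<le> h x"
    using f by (auto simp: g_def[abs_def] h_def[abs_def] intro!: integrable_max)
  have fgh: "f x = g x - h x" for x
    by (auto simp: g_def h_def max_def)
  have F: "(LINT y:{..s}|lborel. f y) = (LINT y:{..s}|lborel. g y) - (LINT y:{..s}|lborel. h y)" for s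
    unfolding fgh using gh by (intro set_integral_diff integrable_imp_set_integrable) auto
  show ?thesis
    using AE_DERIV_indefinite_integral_nonneg[OF gh(1,3)] AE_DERIV_indefinite_integral_nonneg[OF gh(2,4)]
    unfolding F by eventually_elim (auto simp: fgh intro: DERIV_diff)
qed

subsection \<open>The metric derivative\<close>

text \<open>Half-open intervals form an intersection-stable generator, and they are the sets on
  which a Stieltjes measure is given explicitly.\<close>

lemma borel_measure_eqI_Ioc:
  fixes M N :: "real measure"
  assumes "sets M = sets borel" "sets N = sets borel"
    and "\<And>a b. a \<le> b \<Longrightarrow> emeasure M {a<..b} = emeasure N {a<..b}"
    and "\<And>a b. a \<le> b \<Longrightarrow> emeasure M {a<..b} \<noteq> \<infinity>"
  shows "M = N"
proof (rule measure_eqI_generator_eq)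
  let ?E = "range (\<lambda>(a, b). {a<..b::real})"
  show "Int_stable ?E"
  proof (rule Int_stableI_image)
    show "\<exists>k\<in>UNIV. (case i of (a, b) \<Rightarrow> {a<..b}) \<inter> (case j of (a, b) \<Rightarrow> {a<..b}) = (case k of (a, b) \<Rightarrow> {a<..b})"
      for i j :: "real \<times> real"
      by (cases i; cases j) (auto intro!: bexI[of _ "(max (fst i) (fst j), min (snd i) (snd j))"])
  qed
  show "sets M = sigma_sets UNIV ?E" "sets N = sigma_sets UNIV ?E"
    using assms by (auto simp: borel_sigma_sets_Ioc)
  show "emeasure M X = emeasure N X" if "X \<in> ?E" for X
  proof -
    from that obtain a b where "X = {a<..b}" by auto
    then show ?thesis using assms(3)[of a b] by (cases "a \<le> b") auto
  qed
  show "range (\<lambda>n. {- real n<..real n}) \<subseteq> ?E" by auto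
  show "(\<Union>n. {- real n<..real n}) = UNIV"
  proof (rule UNIV_eq_I[symmetric])
    fix x :: real
    obtain n where "\<bar>x\<bar> < real n" using reals_Archimedean2 by blast
    then have "x \<in> {- real n<..real n}" by auto
    then show "x \<in> (\<Union>n. {- real n<..real n})" by blast
  qed
  show "emeasure M {- real n<..real n} \<noteq> \<infinity>" for n
    using assms(4) by simp
qed auto

lemma tendsto_if_dist_le_integral:
  fixes w :: "real \<Rightarrow> 'a::metric_space"
  assumes m: "integrable lborel m"
    and bound: "\<And>s t. s \<le> t \<Longrightarrow> dist (w s) (w t) \<le> (LINT x:{s..t}|lborel. m x)"
  shows "(w \<longlongrightarrow> w t) (at t)"
proof -
  define M where "M t = (LINT x:{..t}|lborel. m x)" for t
  have "((\<lambda>s. \<bar>M s - M t\<bar>) \<longlongrightarrow> 0) (at t)"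
    using continuous_indefinite_integral[OF m, of t] unfolding isCont_def M_def
    by (intro tendsto_rabs_zero LIM_zero)
  moreover have "\<forall>\<^sub>F s in at t. norm (dist (w s) (w t)) \<le> \<bar>M s - M t\<bar>"
  proof (rule always_eventually, rule allI)
    fix s show "norm (dist (w s) (w t)) \<le> \<bar>M s - M t\<bar>"
      using bound[of s t] bound[of t s] indefinite_integral_diff[OF m, of s t] indefinite_integral_diff[OF m, of t s]
      by (cases "s \<le> t") (auto simp: M_def dist_commute)
  qed
  ultimately have "((\<lambda>s. dist (w s) (w t)) \<longlongrightarrow> 0) (at t)"
    by (rule Lim_null_comparison[rotated])
  then show ?thesis by (rule tendsto_dist_iff[THEN iffD2])
qed

text \<open>
  With \<open>M\<close> the indefinite integral of \<open>|m|\<close>, the Stieltjes measures of \<open>M + f\<close> and \<open>M - f\<close> add up to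
  the measure with density \<open>2 |m|\<close>, so Radon-Nikodym applies to the first of them.
\<close>

lemma indefinite_integral_representation:
  fixes f m :: "real \<Rightarrow> real"
  assumes m: "integrable lborel m"
    and bound: "\<And>s t. s \<le> t \<Longrightarrow> \<bar>f t - f s\<bar> \<le> (LINT x:{s..t}|lborel. m x)"
  shows "\<exists>h. integrable lborel h \<and> (\<forall>s t. s \<le> t \<longrightarrow> f t - f s = (LINT x:{s..t}|lborel. h x))"
proof -
  define M where "M t = (LINT x:{..t}|lborel. \<bar>m x\<bar>)" for t
  have m': "integrable lborel (\<lambda>x. \<bar>m x\<bar>)" using m by auto
  have M_cont: "isCont M t" for t
    unfolding M_def by (rule continuous_indefinite_integral[OF m'])
  have M_diff: "M b - M a = (LINT x:{a..b}|lborel. \<bar>m x\<bar>)" if "a \<le> b" for a b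
    unfolding M_def by (rule indefinite_integral_diff[OF m' that])
  have f_M: "\<bar>f t - f s\<bar> \<le> M t - M s" if "s \<le> t" for s t
  proof -
    have "(LINT x:{s..t}|lborel. m x) \<le> (LINT x:{s..t}|lborel. \<bar>m x\<bar>)"
      using m m' by (intro set_integral_mono integrable_imp_set_integrable) auto
    with bound[OF that] M_diff[OF that] show ?thesis by simp
  qed
  have f_cont: "isCont f t" for t
    unfolding isCont_def
    by (rule tendsto_if_dist_le_integral[OF m]) (use bound in \<open>simp add: dist_real_def abs_minus_commute\<close>)
  define G where "G \<sigma> t = M t + \<sigma> * f t" for \<sigma> t
  define N where "N \<sigma> = interval_measure (G \<sigma>)" for \<sigma>
  define D where "D = density lborel (\<lambda>x. ennreal (2 * \<bar>m x\<bar>))"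
  have [simp]: "sets D = sets borel" "sets (N \<sigma>) = sets borel" "space (N \<sigma>) = UNIV" for \<sigma>
    by (auto simp: D_def N_def)
  have G_mono: "G \<sigma> a \<le> G \<sigma> b" if "a \<le> b" "\<sigma> \<in> {1, -1}" for \<sigma> a b
    using f_M[OF that(1)] that(2) by (auto simp: G_def)
  have N_Ioc: "emeasure (N \<sigma>) {a<..b} = ennreal (G \<sigma> b - G \<sigma> a)" if "a \<le> b" "\<sigma> \<in> {1, -1}" for \<sigma> a b
    unfolding N_def
  proof (rule emeasure_interval_measure_Ioc[OF that(1)])
    show "continuous (at_right t) (G \<sigma>)" for t
      unfolding G_def
      by (rule continuous_at_imp_continuous_at_within)
        (rule isCont_add[OF M_cont isCont_mult[OF continuous_const f_cont]])
    show "G \<sigma> x \<le> G \<sigma> y" if "x \<le> y" for x y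
      using that \<open>\<sigma> \<in> {1, -1}\<close> by (rule G_mono)
  qed
  have D_Ioc: "emeasure D {a<..b} = ennreal (2 * (M b - M a))" if "a \<le> b" for a b
  proof -
    have "emeasure D {a<..b} = (\<integral>\<^sup>+x. ennreal (2 * \<bar>m x\<bar>) * indicator {a<..b} x \<partial>lborel)"
      unfolding D_def using m by (intro emeasure_density) auto
    also have "\<dots> = (\<integral>\<^sup>+x. ennreal (2 * (indicator {a..b} x * \<bar>m x\<bar>)) \<partial>lborel)"
      using AE_lborel_singleton[of a]
      by (intro nn_integral_cong_AE) (auto elim!: eventually_mono simp: indicator_def)
    also have "\<dots> = ennreal (2 * (LINT x:{a..b}|lborel. \<bar>m x\<bar>))"
      unfolding set_lebesgue_integral_def
      using m by (subst nn_integral_eq_integral) (auto intro!: integrable_real_mult_indicator simp: mult.commute)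
    finally show ?thesis using that by (simp add: M_diff)
  qed
  define S where "S = measure_of UNIV (sets borel) (\<lambda>A. emeasure (N 1) A + emeasure (N (-1)) A)"
  have [simp]: "sets S = sets borel"
    unfolding S_def using sets.sigma_sets_eq[of "borel :: real measure"] by (simp add: sets_measure_of)
  have S: "emeasure S A = emeasure (N 1) A + emeasure (N (-1)) A" if "A \<in> sets borel" for A
    unfolding S_def
  proof (rule emeasure_measure_of_sigma)
    show "A \<in> sets borel" by (rule that)
    show "sigma_algebra UNIV (sets (borel :: real measure))"
      using sets.sigma_algebra_axioms[of "borel :: real measure"] by simp
    show "positive (sets borel) (\<lambda>A. emeasure (N 1) A + emeasure (N (-1)) A)"
      by (auto simp: positive_def)
    show "countably_additive (sets borel) (\<lambda>A. emeasure (N 1) A + emeasure (N (-1)) A)"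
      unfolding countably_additive_def
      by (auto simp: suminf_add[symmetric] suminf_emeasure)
  qed
  have "S = D"
  proof (rule borel_measure_eqI_Ioc)
    show "emeasure S {a<..b} = emeasure D {a<..b}" if "a \<le> b" for a b
      using that G_mono[of a b 1] G_mono[of a b "-1"]
      by (simp add: S N_Ioc D_Ioc ennreal_plus[symmetric] del: ennreal_plus) (simp add: G_def)
    show "emeasure S {a<..b} \<noteq> \<infinity>" if "a \<le> b" for a b
      using that by (simp add: S N_Ioc)
  qed auto
  \<comment> \<open>Domination by \<open>D\<close> gives more than absolute continuity: it also
    bounds the total mass of \<open>N 1\<close>, which makes its density integrable.\<close>
  then have N_D: "emeasure (N 1) A \<le> emeasure D A" if "A \<in> sets borel" for A
    using S[OF that] by simp
  have "absolutely_continuous lborel (N 1)"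
    unfolding absolutely_continuous_def
  proof
    fix A assume "A \<in> null_sets (lborel :: real measure)"
    moreover have "absolutely_continuous lborel D"
      unfolding D_def using m by (intro absolutely_continuousI_density) auto
    ultimately have "A \<in> null_sets D" by (auto simp: absolutely_continuous_def)
    then show "A \<in> null_sets (N 1)" using N_D[of A] by (auto simp: null_sets_def)
  qed
  then obtain h where h[measurable]: "h \<in> borel_measurable lborel" and N1: "density lborel h = N 1"
    using sigma_finite_measure.Radon_Nikodym[OF sigma_finite_lborel, of "N 1"] by auto
  have "(\<integral>\<^sup>+x. h x \<partial>lborel) = emeasure (N 1) UNIV"
    unfolding N1[symmetric] by (subst emeasure_density) auto
  also have "\<dots> \<le> emeasure D UNIV" by (rule N_D) simp
  also have "\<dots> < \<infinity>"
    unfolding D_def using m by (subst emeasure_density) (auto simp: nn_integral_eq_integral)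
  finally have h_fin: "(\<integral>\<^sup>+x. h x \<partial>lborel) < \<infinity>" .
  then have AE_h: "AE x in lborel. ennreal (enn2real (h x)) = h x"
    using nn_integral_PInf_AE[of h lborel] by (auto elim!: eventually_mono simp: less_top[symmetric])
  have int_h: "integrable lborel (\<lambda>x. enn2real (h x))"
    using h_fin nn_integral_cong_AE[OF AE_h] by (intro integrableI_nonneg) auto
  \<comment> \<open>\<open>h\<close> is the density belonging to M + f, so the density of M has to
    be subtracted.\<close>
  have "f t - f s = (LINT x:{s..t}|lborel. enn2real (h x) - \<bar>m x\<bar>)" if st: "s \<le> t" for s t
  proof -
    have "ennreal (LINT x:{s..t}|lborel. enn2real (h x)) = (\<integral>\<^sup>+x. ennreal (indicator {s..t} x * enn2real (h x)) \<partial>lborel)"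
      unfolding set_lebesgue_integral_def
      using int_h by (subst nn_integral_eq_integral) (auto intro!: integrable_real_mult_indicator simp: mult.commute)
    also have "\<dots> = (\<integral>\<^sup>+x. h x * indicator {s<..t} x \<partial>lborel)"
      using AE_h AE_lborel_singleton[of s]
      by (intro nn_integral_cong_AE) (auto elim!: eventually_elim2 simp: indicator_def)
    also have "\<dots> = emeasure (N 1) {s<..t}"
      unfolding N1[symmetric] by (subst emeasure_density) auto
    finally have "(LINT x:{s..t}|lborel. enn2real (h x)) = G 1 t - G 1 s"
      using st G_mono[of s t 1] by (simp add: N_Ioc set_lebesgue_integral_def)
    moreover have "(LINT x:{s..t}|lborel. enn2real (h x) - \<bar>m x\<bar>) =
        (LINT x:{s..t}|lborel. enn2real (h x)) - (LINT x:{s..t}|lborel. \<bar>m x\<bar>)"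
      using int_h m'
      by (intro set_integral_diff integrable_imp_set_integrable) auto
    ultimately show ?thesis using M_diff[OF st] by (simp add: G_def)
  qed
  then show ?thesis
    using int_h m' by (intro exI[of _ "\<lambda>x. enn2real (h x) - \<bar>m x\<bar>"]) auto
qed


text \<open>
  The metric derivative is the supremum of the derivatives \<open>h n\<close> of the distances to a dense sequence
  of points of the curve. The cut-off by \<open>|m|\<close> only changes a null set and keeps the supremum finite.
\<close>

lemma AE_metric_derivative:
  fixes w :: "real \<Rightarrow> 'a::metric_space"
  assumes m: "integrable lborel m"
    and bound: "\<And>s t. s \<le> t \<Longrightarrow> dist (w s) (w t) \<le> (LINT x:{s..t}|lborel. m x)"
  shows "\<exists>\<mu>. integrable lborel \<mu> \<and> (\<forall>x. 0 \<le> \<mu> x) \<and>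
    (\<forall>s t. s \<le> t \<longrightarrow> dist (w s) (w t) \<le> (LINT x:{s..t}|lborel. \<mu> x)) \<and>
    (AE x in lborel. ((\<lambda>s. dist (w s) (w x) / \<bar>s - x\<bar>) \<longlongrightarrow> \<mu> x) (at x))"
proof -
  define r :: "nat \<Rightarrow> real" where "r = from_nat_into \<rat>"
  have r_range: "range r = \<rat>"
    unfolding r_def by (intro range_from_nat_into countable_rat) auto
  define \<psi> where "\<psi> n t = dist (w t) (w (r n))" for n t
  have \<psi>_dist: "\<bar>\<psi> n t - \<psi> n s\<bar> \<le> dist (w s) (w t)" for n s t
    unfolding \<psi>_def by (metis abs_dist_diff_le dist_commute)
  have "\<exists>h. integrable lborel h \<and> (\<forall>s t. s \<le> t \<longrightarrow> \<psi> n t - \<psi> n s = (LINT x:{s..t}|lborel. h x))" for n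
    by (rule indefinite_integral_representation[OF m]) (rule order_trans[OF \<psi>_dist bound])
  then obtain h where h: "\<And>n. integrable lborel (h n)"
    and \<psi>_h: "\<And>n s t. s \<le> t \<Longrightarrow> \<psi> n t - \<psi> n s = (LINT x:{s..t}|lborel. h n x)"
    by metis
  have [measurable]: "h n \<in> borel_measurable borel" "m \<in> borel_measurable borel" for n
    using h[of n] m by auto
  have \<psi>_deriv: "AE x in lborel. \<forall>n. (\<psi> n has_real_derivative h n x) (at x)"
    unfolding AE_all_countable
  proof
    fix n
    have \<psi>_eq: "\<psi> n = (\<lambda>t. (LINT x:{..t}|lborel. h n x) + (\<psi> n 0 - (LINT x:{..0}|lborel. h n x)))"
    proof
      fix t show "\<psi> n t = (LINT x:{..t}|lborel. h n x) + (\<psi> n 0 - (LINT x:{..0}|lborel. h n x))"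
        using \<psi>_h[of 0 t n] \<psi>_h[of t 0 n] indefinite_integral_diff[OF h, of 0 t n] indefinite_integral_diff[OF h, of t 0 n]
        by (cases "0 \<le> t") auto
    qed
    show "AE x in lborel. (\<psi> n has_real_derivative h n x) (at x)"
      using AE_DERIV_indefinite_integral[OF h, of n]
    proof eventually_elim
      case (elim x)
      from DERIV_add[OF this DERIV_const] show ?case
        by (subst \<psi>_eq) simp
    qed
  qed
  have w_cont: "(w \<longlongrightarrow> w t) (at t)" for t
    by (rule tendsto_if_dist_le_integral[OF m bound])
  define \<mu> where "\<mu> x = (SUP n. min \<bar>h n x\<bar> \<bar>m x\<bar>)" for x
  have bdd: "bdd_above (range (\<lambda>n. min \<bar>h n x\<bar> \<bar>m x\<bar>))" for x
    by (intro bdd_aboveI[of _ "\<bar>m x\<bar>"]) auto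
  have \<mu>_ge: "min \<bar>h n x\<bar> \<bar>m x\<bar> \<le> \<mu> x" for n x
    unfolding \<mu>_def by (intro cSUP_upper bdd) auto
  have \<mu>_nonneg: "0 \<le> \<mu> x" for x
    using \<mu>_ge[of 0 x] by linarith
  have \<mu>_le: "\<mu> x \<le> \<bar>m x\<bar>" for x
    unfolding \<mu>_def by (intro cSUP_least) auto
  have [measurable]: "\<mu> \<in> borel_measurable borel"
    unfolding \<mu>_def by (intro borel_measurable_cSUP bdd) auto
  have \<mu>_int: "integrable lborel \<mu>"
    by (rule Bochner_Integration.integrable_bound[OF m]) (use \<mu>_nonneg \<mu>_le in \<open>auto intro!: AE_I2\<close>)
  have AE_h: "AE x in lborel. \<forall>n. \<bar>h n x\<bar> \<le> \<bar>m x\<bar>"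
    using \<psi>_deriv AE_DERIV_indefinite_integral[OF m]
  proof eventually_elim
    case (elim x)
    show ?case
    proof
      fix n
      define M where "M t = (LINT x:{..t}|lborel. m x)" for t
      have "((\<lambda>y. \<bar>(\<psi> n y - \<psi> n x) / (y - x)\<bar>) \<longlongrightarrow> \<bar>h n x\<bar>) (at x)"
        using elim by (intro tendsto_rabs) (simp add: has_field_derivative_iff)
      moreover have "((\<lambda>y. \<bar>(M y - M x) / (y - x)\<bar>) \<longlongrightarrow> \<bar>m x\<bar>) (at x)"
        using elim unfolding M_def by (intro tendsto_rabs) (simp add: has_field_derivative_iff)
      moreover have "\<bar>(\<psi> n y - \<psi> n x) / (y - x)\<bar> \<le> \<bar>(M y - M x) / (y - x)\<bar>" for y
      proof -
        have "dist (w x) (w y) \<le> \<bar>M y - M x\<bar>"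
          using bound[of x y] bound[of y x] indefinite_integral_diff[OF m, of x y] indefinite_integral_diff[OF m, of y x]
          by (cases "x \<le> y") (auto simp: M_def dist_commute)
        then have "\<bar>\<psi> n y - \<psi> n x\<bar> \<le> \<bar>M y - M x\<bar>"
          using \<psi>_dist[of n y x] by linarith
        then show ?thesis by (simp add: divide_right_mono)
      qed
      ultimately show "\<bar>h n x\<bar> \<le> \<bar>m x\<bar>"
        by (intro tendsto_le[OF _ _ _ always_eventually]) auto
    qed
  qed
  \<comment> \<open>A rational time just to the right of \<open>s\<close> serves as base point: up
    to \<open>e\<close>, the distance of the end points is then the increment of
    \<open>\<psi> n\<close>, which is the integral of \<open>h n\<close>.\<close>
  have \<mu>_bound: "dist (w s) (w t) \<le> (LINT x:{s..t}|lborel. \<mu> x)" if st: "s \<le> t" for s t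
  proof (rule field_le_epsilon)
    fix e :: real assume "0 < e"
    have "\<forall>\<^sub>F x in at s. dist (w x) (w s) < e / 2"
      using tendstoD[OF w_cont, of "e / 2" s] \<open>0 < e\<close> by simp
    then obtain d where d: "d > 0" "\<And>x. x \<noteq> s \<Longrightarrow> dist x s < d \<Longrightarrow> dist (w x) (w s) < e / 2"
      unfolding eventually_at by auto
    obtain q where q: "q \<in> \<rat>" "s < q" "q < s + d"
      using Rats_dense_in_real[of s "s + d"] d by auto
    then obtain n where n: "q = r n" using r_range by blast
    have q': "dist (w q) (w s) < e / 2"
      using q by (intro d) (auto simp: dist_real_def)
    have "dist (w s) (w t) \<le> (\<psi> n t - \<psi> n s) + e"
      using q' dist_triangle[of "w s" "w t" "w q"] by (simp add: \<psi>_def n[symmetric] dist_commute)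
    also have "\<psi> n t - \<psi> n s = (LINT x:{s..t}|lborel. h n x)"
      by (rule \<psi>_h[OF st])
    also have "\<dots> \<le> (LINT x:{s..t}|lborel. \<mu> x)"
    proof -
      have "AE x in lborel. h n x \<le> \<mu> x"
        using AE_h
      proof eventually_elim
        case (elim x)
        then have "\<bar>h n x\<bar> \<le> \<bar>m x\<bar>" by blast
        with \<mu>_ge[of n x] show ?case by linarith
      qed
      then show ?thesis
        using h[of n] \<mu>_int by (intro set_integral_mono_AE integrable_imp_set_integrable) auto
    qed
    finally show "dist (w s) (w t) \<le> (LINT x:{s..t}|lborel. \<mu> x) + e" by simp
  qed
  \<comment> \<open>Each \<open>\<psi> n\<close> changes by at most the distance travelled, so the
    \<open>h n\<close> bound the limit inferior from below; differentiating the integral of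
    \<open>\<mu>\<close> bounds the limit superior from above.\<close>
  have "AE x in lborel. ((\<lambda>s. dist (w s) (w x) / \<bar>s - x\<bar>) \<longlongrightarrow> \<mu> x) (at x)"
    using \<psi>_deriv AE_h AE_DERIV_indefinite_integral[OF \<mu>_int]
  proof eventually_elim
    case (elim x)
    show ?case
    proof (rule order_tendstoI)
      fix a assume "a < \<mu> x"
      then obtain n where "a < min \<bar>h n x\<bar> \<bar>m x\<bar>"
        unfolding \<mu>_def using less_cSUP_iff[OF _ bdd, of a x] by auto
      then have "a < \<bar>h n x\<bar>" by simp
      moreover have "((\<lambda>y. \<bar>(\<psi> n y - \<psi> n x) / (y - x)\<bar>) \<longlongrightarrow> \<bar>h n x\<bar>) (at x)"
        using elim by (intro tendsto_rabs) (simp add: has_field_derivative_iff)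
      ultimately have "\<forall>\<^sub>F y in at x. a < \<bar>(\<psi> n y - \<psi> n x) / (y - x)\<bar>"
        by (rule order_tendstoD(1)[rotated])
      then show "\<forall>\<^sub>F y in at x. a < dist (w y) (w x) / \<bar>y - x\<bar>"
      proof eventually_elim
        case (elim y)
        also have "\<bar>(\<psi> n y - \<psi> n x) / (y - x)\<bar> \<le> dist (w y) (w x) / \<bar>y - x\<bar>"
          using \<psi>_dist[of n y x] by (simp add: divide_right_mono dist_commute)
        finally show ?case .
      qed
    next
      fix a assume a: "\<mu> x < a"
      define U where "U t = (LINT x:{..t}|lborel. \<mu> x)" for t
      have "((\<lambda>y. \<bar>(U y - U x) / (y - x)\<bar>) \<longlongrightarrow> \<bar>\<mu> x\<bar>) (at x)"
        using elim unfolding U_def by (intro tendsto_rabs) (simp add: has_field_derivative_iff)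
      then have "\<forall>\<^sub>F y in at x. \<bar>(U y - U x) / (y - x)\<bar> < a"
        by (rule order_tendstoD(2)) (use a \<mu>_nonneg[of x] in simp)
      then show "\<forall>\<^sub>F y in at x. dist (w y) (w x) / \<bar>y - x\<bar> < a"
      proof eventually_elim
        case (elim y)
        have "dist (w y) (w x) \<le> \<bar>U y - U x\<bar>"
          using \<mu>_bound[of x y] \<mu>_bound[of y x] indefinite_integral_diff[OF \<mu>_int, of x y]
            indefinite_integral_diff[OF \<mu>_int, of y x]
          by (cases "x \<le> y") (auto simp: U_def dist_commute)
        then have "dist (w y) (w x) / \<bar>y - x\<bar> \<le> \<bar>(U y - U x) / (y - x)\<bar>"
          by (simp add: divide_right_mono)
        with elim show ?case by linarith
      qed
    qed
  qed
  with \<mu>_int \<mu>_nonneg \<mu>_bound show ?thesis by blast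
qed

section \<open>Locally absolutely continuous curves\<close>

text \<open>Freezing the curve outside [a, b] turns a locally integrable bound into one that is
  integrable on the whole line, as the preceding lemmas demand, and changes nothing inside the
  interval.\<close>

lemma AC_loc_clamp:
  fixes v :: "real \<Rightarrow> 'a::metric_space"
  assumes v: "AC_loc l \<infinity> v" and "l < ereal a" "a \<le> b"
  shows "\<exists>m. integrable lborel m \<and> (\<forall>s t. s \<le> t \<longrightarrow>
    dist (v (max a (min b s))) (v (max a (min b t))) \<le> (LINT x:{s..t}|lborel. m x))"
proof -
  from v obtain m where "\<forall>s t. l < ereal s \<and> s \<le> t \<longrightarrow> set_integrable lborel {s..t} m"
    and "\<forall>s t. l < ereal s \<and> s \<le> t \<longrightarrow> dist (v s) (v t) \<le> (LINT x:{s..t}|lborel. m x)"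
    unfolding AC_loc_def by auto
  then have m: "\<And>s t. l < ereal s \<Longrightarrow> s \<le> t \<Longrightarrow> set_integrable lborel {s..t} m"
    and bound: "\<And>s t. l < ereal s \<Longrightarrow> s \<le> t \<Longrightarrow> dist (v s) (v t) \<le> (LINT x:{s..t}|lborel. m x)"
    by blast+
  let ?w = "\<lambda>t. v (max a (min b t))"
  define m' where "m' x = indicator {a..b} x * m x" for x
  have m': "integrable lborel m'"
    using m[of a b] assms unfolding m'_def by (simp add: set_integrable_def)
  have "dist (?w s) (?w t) \<le> (LINT x:{s..t}|lborel. m' x)" if st: "s \<le> t" for s t
  proof (cases "t < a \<or> b < s")
    case True
    then have "{s..t} \<inter> {a..b} = {}" by auto
    then have "(\<lambda>x. indicator {s..t} x *\<^sub>R m' x) = (\<lambda>_. 0)"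
      by (auto simp: m'_def indicator_def)
    then have "(LINT x:{s..t}|lborel. m' x) = 0"
      by (simp only: set_lebesgue_integral_def) simp
    with True st \<open>a \<le> b\<close> show ?thesis
      by (auto simp: min_def max_def)
  next
    case False
    have "indicator {s..t} x *\<^sub>R m' x = indicator {max a s..min b t} x *\<^sub>R m x" for x
      using False \<open>a \<le> b\<close> st by (auto simp: m'_def indicator_def)
    moreover have "?w s = v (max a s)" "?w t = v (min b t)"
      using False \<open>a \<le> b\<close> st by (auto simp: max_def min_def)
    moreover have "l < ereal (max a s)"
      using \<open>l < ereal a\<close> by (auto simp: max_def intro: less_le_trans)
    ultimately show ?thesis
      using bound[of "max a s" "min b t"] False st \<open>a \<le> b\<close>
      by (auto simp: set_lebesgue_integral_def)
  qed
  with m' show ?thesis by blast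
qed

lemma AC_loc_continuous_on:
  fixes v :: "real \<Rightarrow> 'a::metric_space"
  assumes v: "AC_loc l \<infinity> v"
  shows "continuous_on {t. l < ereal t} v"
  unfolding continuous_on_def
proof
  fix t assume "t \<in> {t. l < ereal t}"
  then obtain a where a: "l < ereal a" "a < t"
    using ereal_dense2[of l "ereal t"] by auto
  let ?w = "\<lambda>s. v (max a (min (t + 1) s))"
  obtain m where m: "integrable lborel m"
    "\<forall>s t'. s \<le> t' \<longrightarrow> dist (?w s) (?w t') \<le> (LINT x:{s..t'}|lborel. m x)"
    using AC_loc_clamp[OF v a(1), of "t + 1"] a by auto
  have "(?w \<longlongrightarrow> ?w t) (at t)"
    by (rule tendsto_if_dist_le_integral[OF m(1)]) (use m(2) in blast)
  moreover have "\<forall>\<^sub>F s in at t. ?w s = v s"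
  proof -
    have "\<forall>\<^sub>F s in at t. s \<in> {a<..<t + 1}"
      using a by (intro eventually_at_in_open') auto
    then show ?thesis by eventually_elim auto
  qed
  ultimately have "(v \<longlongrightarrow> v t) (at t)"
    using a by (simp add: tendsto_cong)
  then show "(v \<longlongrightarrow> v t) (at t within {t. l < ereal t})"
    by (rule tendsto_within_subset) auto
qed

text \<open>\<open>metric_deriv\<close> is a \<open>Lim\<close>, arbitrary where the limit does not
  exist, so neither its measurability nor its sign is known everywhere. The Borel function
  \<open>\<mu>\<close> represents it up to a null set, a difference that the nonnegative integral
  does not see.\<close>

lemma AC_loc_metric_deriv:
  fixes v :: "real \<Rightarrow> 'a::metric_space"
  assumes v: "AC_loc l \<infinity> v" and "l < ereal a" "a \<le> b"
  shows "\<exists>\<mu>. \<mu> \<in> borel_measurable borel \<and>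
    (AE x in lborel. a < x \<and> x < b \<longrightarrow> metric_deriv v x = \<mu> x \<and> 0 \<le> \<mu> x) \<and>
    (\<forall>s t. a \<le> s \<and> s \<le> t \<and> t \<le> b \<longrightarrow>
      ennreal (dist (v s) (v t)) \<le> (\<integral>\<^sup>+x\<in>{s..t}. ennreal (metric_deriv v x) \<partial>lborel))"
proof -
  define w where "w t = v (max a (min b t))" for t
  obtain m where m: "integrable lborel m"
    and "\<forall>s t. s \<le> t \<longrightarrow> dist (w s) (w t) \<le> (LINT x:{s..t}|lborel. m x)"
    using AC_loc_clamp[OF assms] unfolding w_def by blast
  then have "\<And>s t. s \<le> t \<Longrightarrow> dist (w s) (w t) \<le> (LINT x:{s..t}|lborel. m x)"
    by blast
  from AE_metric_derivative[OF m this] obtain \<mu> where \<mu>: "integrable lborel \<mu>" "\<And>x. 0 \<le> \<mu> x"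
    and \<mu>_bound: "\<And>s t. s \<le> t \<Longrightarrow> dist (w s) (w t) \<le> (LINT x:{s..t}|lborel. \<mu> x)"
    and \<mu>_lim: "AE x in lborel. ((\<lambda>s. dist (w s) (w x) / \<bar>s - x\<bar>) \<longlongrightarrow> \<mu> x) (at x)"
    by blast
  have \<mu>_eq: "AE x in lborel. a < x \<and> x < b \<longrightarrow> metric_deriv v x = \<mu> x"
    using \<mu>_lim
  proof (eventually_elim, intro impI)
    fix x assume lim: "((\<lambda>s. dist (w s) (w x) / \<bar>s - x\<bar>) \<longlongrightarrow> \<mu> x) (at x)" and x: "a < x \<and> x < b"
    have "\<forall>\<^sub>F s in at x. s \<in> {a<..<b}"
      using x by (intro eventually_at_in_open') auto
    then have "\<forall>\<^sub>F s in at x. dist (w s) (w x) / \<bar>s - x\<bar> = dist (v s) (v x) / \<bar>s - x\<bar>"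
      by eventually_elim (use x in \<open>auto simp: w_def\<close>)
    with lim have "((\<lambda>s. dist (v s) (v x) / \<bar>s - x\<bar>) \<longlongrightarrow> \<mu> x) (at x)"
      by (simp cong: tendsto_cong)
    then show "metric_deriv v x = \<mu> x"
      unfolding metric_deriv_def by (intro tendsto_Lim) auto
  qed
  have "ennreal (dist (v s) (v t)) \<le> (\<integral>\<^sup>+x\<in>{s..t}. ennreal (metric_deriv v x) \<partial>lborel)"
    if st: "a \<le> s" "s \<le> t" "t \<le> b" for s t
  proof -
    have "ennreal (dist (v s) (v t)) \<le> ennreal (LINT x:{s..t}|lborel. \<mu> x)"
      using \<mu>_bound[of s t] st by (auto simp: w_def intro!: ennreal_leI)
    also have "\<dots> = (\<integral>\<^sup>+x. ennreal (indicator {s..t} x * \<mu> x) \<partial>lborel)"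
      unfolding set_lebesgue_integral_def using \<mu>
      by (subst nn_integral_eq_integral) (auto intro!: integrable_real_mult_indicator simp: mult.commute)
    also have "\<dots> = (\<integral>\<^sup>+x\<in>{s..t}. ennreal (metric_deriv v x) \<partial>lborel)"
      using \<mu>_eq AE_lborel_singleton[of s] AE_lborel_singleton[of t]
      by (intro nn_integral_cong_AE, eventually_elim) (use st in \<open>auto simp: indicator_def\<close>)
    finally show ?thesis .
  qed
  with \<mu> \<mu>_eq show ?thesis by (intro exI[of _ \<mu>]) auto
qed

subsection \<open>The energy identity\<close>

text \<open>The integral of a difference quotient telescopes: shifting by \<open>h n\<close> trades
  the integral of \<open>G\<close> near \<open>s\<close> for the one over [t, t + h n], where
  \<open>G\<close> is at most F t - F s. Equality may fail, as for a jump or the Cantor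
  function.\<close>

lemma nn_integral_DERIV_mono_le:
  fixes F D :: "real \<Rightarrow> real"
  assumes st: "s \<le> t"
    and mono: "mono_on {s..t} F"
    and deriv: "AE x in lborel. s < x \<and> x < t \<longrightarrow> (F has_real_derivative D x) (at x)"
  shows "(\<integral>\<^sup>+x\<in>{s..t}. ennreal (D x) \<partial>lborel) \<le> ennreal (F t - F s)"
proof -
  \<comment> \<open>Subtracting \<open>F s\<close> makes \<open>G\<close> nonnegative and freezing
    extends it beyond \<open>t\<close>, so that neither its values nor its quotients are truncated
    by \<open>ennreal\<close>.\<close>
  define G where "G x = F (max s (min t x)) - F s" for x
  have G_mono: "G x \<le> G y" if "x \<le> y" for x y
    unfolding G_def using st that by (auto intro!: mono_onD[OF mono])
  have [measurable]: "G \<in> borel_measurable borel"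
    by (intro borel_measurable_mono monoI G_mono)
  have G_nonneg: "0 \<le> G x" for x
    unfolding G_def using st by (auto intro!: mono_onD[OF mono])
  have G_le: "G x \<le> F t - F s" for x
    unfolding G_def using st by (auto intro!: mono_onD[OF mono])
  define h where "h n = 1 / (real n + 1)" for n
  have h_pos: "0 < h n" for n by (simp add: h_def)
  have h_lim: "h \<longlonglongrightarrow> 0"
    unfolding h_def using LIMSEQ_inverse_real_of_nat by (simp add: inverse_eq_divide add.commute)
  define Q where "Q n x = (G (x + h n) - G x) / h n" for n x
  have Q_int: "(\<integral>\<^sup>+x\<in>{s..t}. ennreal (Q n x) \<partial>lborel) \<le> ennreal (F t - F s)" for n
  proof -
    let ?I = "\<integral>\<^sup>+x\<in>{s..t}. ennreal (G x) \<partial>lborel"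
    \<comment> \<open>\<open>?I\<close> will stand on both sides; \<open>ennreal\<close> allows
      cancelling it only when it is finite.\<close>
    have fin: "?I < \<infinity>"
    proof -
      have "?I \<le> (\<integral>\<^sup>+x\<in>{s..t}. ennreal (F t - F s) \<partial>lborel)"
        by (intro nn_integral_mono) (auto simp: indicator_def intro!: ennreal_leI G_le)
      also have "\<dots> < \<infinity>"
        using st by (simp add: nn_integral_cmult_indicator ennreal_mult_less_top)
      finally show ?thesis .
    qed
    have "ennreal (h n) * (\<integral>\<^sup>+x\<in>{s..t}. ennreal (Q n x) \<partial>lborel) + ?I =
        (\<integral>\<^sup>+x\<in>{s..t}. (ennreal (h n) * ennreal (Q n x) + ennreal (G x)) \<partial>lborel)"
      by (subst nn_integral_cmult[symmetric], simp add: Q_def, subst nn_integral_add[symmetric])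
        (auto simp: Q_def distrib_right mult.assoc intro!: nn_integral_cong)
    also have "\<dots> = (\<integral>\<^sup>+x\<in>{s..t}. ennreal (G (x + h n)) \<partial>lborel)"
    proof -
      have "ennreal (h n) * ennreal (Q n x) + ennreal (G x) = ennreal (G (x + h n))" for x
        using h_pos[of n] G_mono[of x "x + h n"] G_nonneg[of x]
        by (simp add: Q_def ennreal_mult[symmetric] ennreal_plus[symmetric] del: ennreal_plus)
      then show ?thesis by simp
    qed
    also have "\<dots> = (\<integral>\<^sup>+x\<in>{s + h n..t + h n}. ennreal (G x) \<partial>lborel)"
      by (subst nn_integral_real_affine[where c = 1 and t = "h n"])
        (auto simp: indicator_def add.commute intro!: nn_integral_cong)
    also have "\<dots> \<le> (\<integral>\<^sup>+x. ennreal (G x) * indicator {s..t} x + ennreal (F t - F s) * indicator {t..t + h n} x \<partial>lborel)"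
      using h_pos[of n]
      by (intro nn_integral_mono) (auto simp: indicator_def intro!: ennreal_leI G_le)
    also have "\<dots> = ?I + ennreal (h n) * ennreal (F t - F s)"
      using h_pos[of n]
      by (subst nn_integral_add) (auto simp: nn_integral_cmult_indicator mult.commute)
    finally have "ennreal (h n) * (\<integral>\<^sup>+x\<in>{s..t}. ennreal (Q n x) \<partial>lborel) \<le> ennreal (h n) * ennreal (F t - F s)"
      using fin by (subst (asm) add.commute) (simp add: ennreal_add_left_cancel_le less_top[symmetric])
    then show ?thesis
      using h_pos[of n] by (simp add: ennreal_mult_le_mult_iff)
  qed
  have "(\<integral>\<^sup>+x\<in>{s..t}. ennreal (D x) \<partial>lborel) =
      (\<integral>\<^sup>+x. liminf (\<lambda>n. ennreal (Q n x) * indicator {s..t} x) \<partial>lborel)"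
  proof (rule nn_integral_cong_AE)
    show "AE x in lborel. ennreal (D x) * indicator {s..t} x =
        liminf (\<lambda>n. ennreal (Q n x) * indicator {s..t} x)"
      using deriv AE_lborel_singleton[of s] AE_lborel_singleton[of t]
    proof eventually_elim
      case (elim x)
      show ?case
      proof (cases "s < x \<and> x < t")
        case True
        with elim have "(F has_real_derivative D x) (at x)" by auto
        then have "((\<lambda>x. F x - F s) has_real_derivative D x) (at x)"
          by (auto intro!: derivative_eq_intros)
        moreover have "\<forall>\<^sub>F y in nhds x. F y - F s = G y"
        proof -
          have "\<forall>\<^sub>F y in nhds x. y \<in> {s<..<t}"
            using True by (intro eventually_nhds_in_open) auto
          then show ?thesis by eventually_elim (auto simp: G_def max_def min_def)
        qed
        ultimately have "(G has_real_derivative D x) (at x)"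
          by (subst (asm) DERIV_cong_ev) auto
        then have "((\<lambda>k. (G (x + k) - G x) / k) \<longlongrightarrow> D x) (at 0)"
          by (simp add: DERIV_def)
        moreover have "filterlim h (at 0) sequentially"
          using h_lim h_pos by (auto simp: filterlim_at less_imp_neq[symmetric])
        ultimately have "(\<lambda>n. Q n x) \<longlonglongrightarrow> D x"
          unfolding Q_def by (rule filterlim_compose)
        then have "(\<lambda>n. ennreal (Q n x)) \<longlonglongrightarrow> ennreal (D x)"
          by (rule tendsto_ennrealI)
        with True show ?thesis
          by (auto simp: lim_imp_Liminf)
      next
        case False
        with elim show ?thesis by (auto simp: Liminf_const)
      qed
    qed
  qed
  also have "\<dots> \<le> liminf (\<lambda>n. \<integral>\<^sup>+x\<in>{s..t}. ennreal (Q n x) \<partial>lborel)"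
    by (intro nn_integral_liminf) (auto simp: Q_def)
  also have "\<dots> \<le> ennreal (F t - F s)"
    using Liminf_mono[OF always_eventually, of "\<lambda>n. \<integral>\<^sup>+x\<in>{s..t}. ennreal (Q n x) \<partial>lborel" "\<lambda>_. ennreal (F t - F s)" sequentially] Q_int
    by (simp add: Liminf_const)
  finally show ?thesis .
qed

text \<open>In logarithmic coordinates the two powers are exp x and exp y, and a * b is exp w with w
  the weighted mean of x and y. The hypothesis then reverses the convexity inequality of exp, which
  is strict unless x = y = w. Zero arguments have no logarithm and are treated separately.\<close>

lemma Youngs_equality:
  fixes p a b :: real
  assumes p: "1 < p" and ab: "0 \<le> a" "0 \<le> b"
    and le: "a powr conj_exp p / conj_exp p + b powr p / p \<le> a * b"
  shows "a powr conj_exp p = a * b" "b powr p = a * b"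
proof -
  define q where "q = conj_exp p"
  have q: "1 < q" "1 / q + 1 / p = 1"
    using p by (auto simp: q_def conj_exp_def field_simps)
  have "a powr q = a * b \<and> b powr p = a * b"
  proof (cases "a = 0 \<or> b = 0")
    case True
    then show ?thesis
    proof
      assume "a = 0"
      then have "b powr p / p \<le> 0"
        using le by (simp add: q_def)
      then have "b powr p = 0"
        using p by (simp add: divide_le_0_iff)
      with \<open>a = 0\<close> p show ?thesis by simp
    next
      assume "b = 0"
      then have "a powr q / q \<le> 0"
        using le by (simp add: q_def)
      then have "a powr q = 0"
        using q by (simp add: divide_le_0_iff)
      with \<open>b = 0\<close> q show ?thesis by simp
    qed
  next
    case False
    define x where "x = q * ln a"
    define y where "y = p * ln b"
    define w where "w = x / q + y / p"
    have a: "a powr q = exp x" and b: "b powr p = exp y" and w: "a * b = exp w"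
      using False ab p q by (auto simp: powr_def x_def y_def w_def exp_add)
    have *: "exp x / q + exp y / p \<le> exp w"
      using le by (simp add: q_def[symmetric] a b w)
    have 1: "exp (x - w) / q + exp (y - w) / p \<le> 1"
    proof -
      have "(exp x / q + exp y / p) / exp w \<le> 1"
        using * by (simp add: divide_le_eq)
      then show ?thesis by (simp add: exp_diff add_divide_distrib mult.commute)
    qed
    have w': "(x - w) / q + (y - w) / p = 0"
    proof -
      have "(x - w) / q + (y - w) / p = x / q + y / p - w * (1 / q + 1 / p)"
        by (simp add: diff_divide_distrib distrib_left)
      also have "\<dots> = 0"
        by (subst q(2)) (simp add: w_def)
      finally show ?thesis .
    qed
    have x0: "0 \<le> (exp (x - w) - (1 + (x - w))) / q" and y0: "0 \<le> (exp (y - w) - (1 + (y - w))) / p"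
      using p q by (simp_all add: exp_ge_add_one_self)
    \<comment> \<open>Both defects in exp z \<ge> 1 + z are nonnegative, while the hypothesis and
      the vanishing weighted mean make their weighted sum at most 0.\<close>
    have "(exp (x - w) - (1 + (x - w))) / q + (exp (y - w) - (1 + (y - w))) / p
        = exp (x - w) / q + exp (y - w) / p - (1 / q + 1 / p) - ((x - w) / q + (y - w) / p)"
      by (simp add: diff_divide_distrib add_divide_distrib)
    also have "\<dots> \<le> 0" using 1 q w' by simp
    finally have "(exp (x - w) - (1 + (x - w))) / q = 0" "(exp (y - w) - (1 + (y - w))) / p = 0"
      using x0 y0 by linarith+
    then have "exp (x - w) = 1 + (x - w)" "exp (y - w) = 1 + (y - w)"
      using p q by auto
    moreover have "z = 0" if "exp z = 1 + z" for z :: real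
    proof -
      have "ln (exp z) = exp z - 1"
        unfolding ln_exp using that by simp
      then have "exp z = 1"
        by (rule ln_eq_minus_one[OF exp_gt_zero])
      then show ?thesis by simp
    qed
    ultimately have "x - w = 0" "y - w = 0" by blast+
    then have "x = w" "y = w" by auto
    then show ?thesis by (simp add: a b w)
  qed
  then show "a powr conj_exp p = a * b" "b powr p = a * b"
    by (auto simp: q_def)
qed

lemma AE_eq_if_nn_integral_ge:
  assumes [measurable]: "f \<in> borel_measurable M" "h \<in> borel_measurable M"
    and le: "AE x in M. f x \<le> h x"
    and ge: "integral\<^sup>N M h \<le> integral\<^sup>N M f" and fin: "integral\<^sup>N M f < \<infinity>"
  shows "AE x in M. f x = h x"
proof -
  have "(\<integral>\<^sup>+x. h x - f x \<partial>M) = integral\<^sup>N M h - integral\<^sup>N M f"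
    using le fin by (intro nn_integral_diff) auto
  also have "\<dots> = 0"
    using ge fin by (intro diff_eq_0_ennreal) (auto intro: le_less_trans)
  finally have "AE x in M. h x - f x = 0"
    by (subst (asm) nn_integral_0_iff_AE) auto
  with le show ?thesis
    by eventually_elim (auto simp: ennreal_minus_eq_0 intro: antisym)
qed

text \<open>The \<open>lim\<close> of the difference quotients along the steps 1 / (n + 1) is Borel
  measurable on the whole line and equals the derivative wherever that exists, so the exceptional
  set never has to be described.\<close>

lemma deriv_mono_AE_measurable:
  fixes F :: "real \<Rightarrow> real"
  assumes ab: "a \<le> b" and mono: "mono_on {a..b} F"
  shows "\<exists>k. k \<in> borel_measurable borel \<and>
    (\<forall>x D. a < x \<and> x < b \<and> (F has_real_derivative D) (at x) \<longrightarrow> k x = D)"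
proof -
  define G where "G x = F (max a (min b x))" for x
  define h where "h n = 1 / (real n + 1)" for n
  have h_lim: "h \<longlonglongrightarrow> 0"
    unfolding h_def using LIMSEQ_inverse_real_of_nat by (simp add: inverse_eq_divide add.commute)
  have h0: "filterlim h (at 0) sequentially"
    using h_lim by (auto simp: filterlim_at h_def intro!: always_eventually)
  have "mono G"
    unfolding G_def using ab by (auto intro!: monoI mono_onD[OF mono])
  then have [measurable]: "G \<in> borel_measurable borel"
    by (rule borel_measurable_mono)
  define k where "k x = lim (\<lambda>n. (G (x + h n) - G x) / h n)" for x
  have "k \<in> borel_measurable borel"
    unfolding k_def by measurable
  moreover have "k x = D" if x: "a < x" "x < b" and D: "(F has_real_derivative D) (at x)" for x D
  proof -
    have "\<forall>\<^sub>F y in nhds x. y \<in> {a<..<b}"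
      using x by (intro eventually_nhds_in_open) auto
    then have "\<forall>\<^sub>F y in nhds x. F y = G y"
      by eventually_elim (auto simp: G_def)
    with D have "(G has_real_derivative D) (at x)"
      by (subst (asm) DERIV_cong_ev) auto
    then have "((\<lambda>k. (G (x + k) - G x) / k) \<longlongrightarrow> D) (at 0)"
      by (simp add: DERIV_def)
    from filterlim_compose[OF this h0] show "k x = D"
      unfolding k_def by (rule limI)
  qed
  ultimately show ?thesis by blast
qed

section \<open>Equality in the dissipation inequality along the flow\<close>

lemma gradient_flow_AC:
  fixes a b :: real
  assumes "gradient_flow p E g v" "0 < a"
  shows "AC a b v"
proof -
  obtain m where m: "\<forall>s t. 0 < ereal s \<and> s \<le> t \<and> ereal t < \<infinity> \<longrightarrow> set_integrable lborel {s..t} m"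
    and bound: "\<forall>s t. 0 < ereal s \<and> s \<le> t \<and> ereal t < \<infinity> \<longrightarrow>
        dist (v s) (v t) \<le> set_lebesgue_integral lborel {s..t} m"
    using assms unfolding gradient_flow_def AC_loc_def by blast
  \<comment> \<open>The maximum covers b < a, where the open interval is empty.\<close>
  have "set_integrable lborel {a..max a b} m"
    using m assms by simp
  then have "set_integrable lborel (einterval a b) m"
    by (rule set_integrable_subset) auto
  with bound assms show ?thesis
    unfolding AC_def by (intro exI[of _ m]) (auto intro: less_trans)
qed

text \<open>Absolute continuity of \<open>e\<close> is not presupposed. Monotonicity bounds the
  integral of - e' by e a - e b, and the upper gradient bounds e a - e b by the integral of g(v)
  |v'|, which lies below - e' pointwise. All three quantities therefore coincide and are finite, so
  the pointwise inequality is an equality almost everywhere.\<close>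

lemma gradient_flow_energy_identity_on:
  fixes E :: "'a::metric_space \<Rightarrow> ereal" and v :: "real \<Rightarrow> 'a"
  defines "e \<equiv> \<lambda>s. real_of_ereal (E (v s))"
  assumes p: "1 < p" and sug: "strong_upper_gradient E g" and flow: "gradient_flow p E g v"
    and ab: "0 < a" "a < b"
  shows "AE t in lborel. a < t \<and> t < b \<longrightarrow> g (v t) < \<infinity> \<and> 0 \<le> metric_deriv v t \<and>
    (e has_real_derivative - (enn2real (g (v t)) * metric_deriv v t)) (at t) \<and>
    enn2real (g (v t)) powr conj_exp p = enn2real (g (v t)) * metric_deriv v t \<and>
    metric_deriv v t powr p = enn2real (g (v t)) * metric_deriv v t"
proof -
  define q where "q = conj_exp p"
  have q: "1 < q" "1 / q + 1 / p = 1"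
    using p by (auto simp: q_def conj_exp_def field_simps)
  have E_fin: "E (v t) = ereal (e t)" if "0 < t" for t
    using flow that unfolding gradient_flow_def e_def by (auto simp: ereal_real)
  have e_antimono: "e t \<le> e s" if "0 < s" "s \<le> t" for s t
  proof -
    have "E (v t) \<le> E (v s)"
      using flow that unfolding gradient_flow_def by blast
    with that show ?thesis by (simp add: E_fin)
  qed
  have deriv: "AE t in lborel. 0 < t \<longrightarrow> g (v t) < \<infinity> \<and> (e has_real_derivative deriv e t) (at t) \<and>
      deriv e t \<le> - (enn2real (g (v t)) powr q / q) - metric_deriv v t powr p / p"
  proof -
    have "AE t in lborel. 0 < t \<longrightarrow> g (v t) < \<infinity> \<and> (\<exists>D. (e has_real_derivative D) (at t) \<and>
        D \<le> - (1 / q) * enn2real (g (v t)) powr q - (1 / p) * metric_deriv v t powr p)"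
      using flow unfolding gradient_flow_def e_def q_def by blast
    then show ?thesis
      by eventually_elim (auto simp: DERIV_imp_deriv)
  qed
  have v: "AC_loc 0 \<infinity> v" using flow by (simp add: gradient_flow_def)
  obtain \<mu> where \<mu>[measurable]: "\<mu> \<in> borel_measurable borel"
    and \<mu>_eq: "AE x in lborel. a < x \<and> x < b \<longrightarrow> metric_deriv v x = \<mu> x \<and> 0 \<le> \<mu> x"
    using AC_loc_metric_deriv[OF v, of a b] ab by auto
  have mono: "mono_on {a..b} (\<lambda>t. - e t)"
    using ab by (auto intro!: mono_onI e_antimono)
  obtain k where k[measurable]: "k \<in> borel_measurable borel"
    and k_eq: "\<And>x D. \<lbrakk>a < x; x < b; ((\<lambda>t. - e t) has_real_derivative D) (at x)\<rbrakk> \<Longrightarrow> k x = D"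
    using deriv_mono_AE_measurable[OF _ mono] ab by auto
  have k_AE: "AE t in lborel. a < t \<and> t < b \<longrightarrow> k t = - deriv e t"
    using deriv by eventually_elim (use ab in \<open>auto intro!: k_eq DERIV_minus\<close>)
  \<comment> \<open>The upper gradient inequality holds for times strictly inside the interval of
    the curve; enlarging it admits \<open>a\<close> and \<open>b\<close> themselves.\<close>
  have AC: "AC (a / 2) (b + 1) v"
    using gradient_flow_AC[OF flow, of "a / 2" "b + 1"] ab by simp
  have "(\<lambda>t. g (v t)) \<in> borel_measurable (restrict_space borel (einterval (a / 2) (b + 1)))"
    using sug AC unfolding strong_upper_gradient_def by blast
  then have g_meas: "(\<lambda>t. g (v t) * indicator {a<..<b} t) \<in> borel_measurable borel"
  proof -
    assume "(\<lambda>t. g (v t)) \<in> borel_measurable (restrict_space borel (einterval (a / 2) (b + 1)))"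
    then have "(\<lambda>t. g (v t)) \<in> borel_measurable (restrict_space borel {a<..<b})"
      by (rule measurable_restrict_mono) (use ab in auto)
    then show ?thesis
      by (subst (asm) borel_measurable_restrict_space_iff_ennreal) auto
  qed
  \<comment> \<open>\<open>f\<close> stands for g(v) |v'| and \<open>h\<close> for - e', both cut
    off to (a, b) and written with Borel representatives.\<close>
  define f where "f t = (g (v t) * indicator {a<..<b} t) * ennreal (\<mu> t)" for t
  define h where "h t = ennreal (k t) * indicator {a<..<b} t" for t
  have [measurable]: "f \<in> borel_measurable lborel" "h \<in> borel_measurable lborel"
    unfolding f_def h_def using g_meas by measurable
  have facts: "AE t in lborel. a < t \<and> t < b \<longrightarrow> g (v t) < \<infinity> \<and> (e has_real_derivative - k t) (at t) \<and>
      enn2real (g (v t)) powr q / q + \<mu> t powr p / p \<le> k t \<and> metric_deriv v t = \<mu> t \<and> 0 \<le> \<mu> t"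
    using deriv k_AE \<mu>_eq by eventually_elim (use ab in auto)
  have "AE t in lborel. f t = h t"
  proof (rule AE_eq_if_nn_integral_ge)
    show "AE t in lborel. f t \<le> h t"
      using facts
    proof eventually_elim
      case (elim t)
      show ?case
      proof (cases "a < t \<and> t < b")
        case True
        with elim have t: "g (v t) < \<infinity>" "0 \<le> \<mu> t" "enn2real (g (v t)) powr q / q + \<mu> t powr p / p \<le> k t"
          by auto
        have "enn2real (g (v t)) * \<mu> t \<le> enn2real (g (v t)) powr q / q + \<mu> t powr p / p"
          using p q t by (intro Youngs_inequality) auto
        with t have "ennreal (enn2real (g (v t)) * \<mu> t) \<le> ennreal (k t)"
          by (intro ennreal_leI) auto
        with t True show ?thesis
          by (simp add: f_def h_def ennreal_mult less_top)
      qed (auto simp: f_def)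
    qed
    have h_le: "(\<integral>\<^sup>+t. h t \<partial>lborel) \<le> ennreal (e a - e b)"
    proof -
      have "(\<integral>\<^sup>+t\<in>{a..b}. ennreal (k t) \<partial>lborel) \<le> ennreal (- e b - - e a)"
      proof (rule nn_integral_DERIV_mono_le[OF _ mono])
        show "AE x in lborel. a < x \<and> x < b \<longrightarrow> ((\<lambda>t. - e t) has_real_derivative k x) (at x)"
          using facts by eventually_elim (auto dest: DERIV_minus)
      qed (use ab in simp)
      moreover have "(\<integral>\<^sup>+t. h t \<partial>lborel) \<le> (\<integral>\<^sup>+t\<in>{a..b}. ennreal (k t) \<partial>lborel)"
        by (intro nn_integral_mono) (auto simp: h_def indicator_def)
      ultimately show ?thesis by simp
    qed
    have f_ge: "ennreal (e a - e b) \<le> (\<integral>\<^sup>+t. f t \<partial>lborel)"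
    proof -
      have "ereal (a / 2) < ereal a" "ereal b < ereal (b + 1)" "E (v a) < \<infinity>"
        using ab E_fin[of a] by auto
      moreover have "\<forall>s t. ereal (a / 2) < ereal s \<and> s \<le> t \<and> ereal t < ereal (b + 1) \<and> (E (v s) < \<infinity> \<or> E (v t) < \<infinity>) \<longrightarrow>
          \<bar>E (v t) - E (v s)\<bar> \<le> enn2ereal (\<integral>\<^sup>+ r\<in>{s..t}. (g (v r) * ennreal (metric_deriv v r)) \<partial>lborel)"
        using sug AC unfolding strong_upper_gradient_def by blast
      ultimately have "\<bar>E (v b) - E (v a)\<bar> \<le>
          enn2ereal (\<integral>\<^sup>+ r\<in>{a..b}. (g (v r) * ennreal (metric_deriv v r)) \<partial>lborel)"
        using less_imp_le[OF ab(2)] by blast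
      moreover have "ereal (e a - e b) \<le> \<bar>E (v b) - E (v a)\<bar>"
        using ab by (simp add: E_fin)
      ultimately have "e2ennreal (ereal (e a - e b)) \<le> (\<integral>\<^sup>+ r\<in>{a..b}. (g (v r) * ennreal (metric_deriv v r)) \<partial>lborel)"
        by (metis e2ennreal_enn2ereal e2ennreal_mono order_trans)
      moreover have "(\<integral>\<^sup>+ r\<in>{a..b}. (g (v r) * ennreal (metric_deriv v r)) \<partial>lborel) = (\<integral>\<^sup>+t. f t \<partial>lborel)"
        using \<mu>_eq AE_lborel_singleton[of a] AE_lborel_singleton[of b]
        by (intro nn_integral_cong_AE, eventually_elim) (auto simp: f_def indicator_def)
      ultimately show ?thesis by (simp add: ennreal.abs_eq)
    qed
    from order_trans[OF h_le f_ge] show "integral\<^sup>N lborel h \<le> integral\<^sup>N lborel f" .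
    have "(\<integral>\<^sup>+t. f t \<partial>lborel) \<le> (\<integral>\<^sup>+t. h t \<partial>lborel)"
      using \<open>AE t in lborel. f t \<le> h t\<close> by (rule nn_integral_mono_AE)
    also note h_le
    finally show "(\<integral>\<^sup>+t. f t \<partial>lborel) < \<infinity>"
      by (rule le_less_trans) simp
  qed auto
  with facts show ?thesis
  proof (eventually_elim, intro impI)
    fix t
    assume *: "a < t \<and> t < b \<longrightarrow> g (v t) < \<infinity> \<and> (e has_real_derivative - k t) (at t) \<and>
        enn2real (g (v t)) powr q / q + \<mu> t powr p / p \<le> k t \<and> metric_deriv v t = \<mu> t \<and> 0 \<le> \<mu> t"
      and fh: "f t = h t" and t: "a < t \<and> t < b"
    let ?G = "enn2real (g (v t))"
    \<comment> \<open>This is needed to return from \<open>ennreal\<close>, which sends negative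
      reals to 0.\<close>
    have k_nonneg: "0 \<le> k t"
    proof -
      have "0 \<le> ?G powr q / q + \<mu> t powr p / p" using p q by simp
      with * t show ?thesis by linarith
    qed
    have "g (v t) * ennreal (\<mu> t) = ennreal (k t)"
      using fh t by (simp add: f_def h_def)
    moreover have "g (v t) * ennreal (\<mu> t) = ennreal (?G * \<mu> t)"
      using * t by (simp add: ennreal_mult less_top)
    ultimately have k: "k t = ?G * \<mu> t"
      using * t k_nonneg by simp
    have "?G powr conj_exp p / conj_exp p + \<mu> t powr p / p \<le> ?G * \<mu> t"
      using * t k by (simp add: q_def)
    from Youngs_equality[OF p _ _ this] * t k
    show "g (v t) < \<infinity> \<and> 0 \<le> metric_deriv v t \<and>
      (e has_real_derivative - (?G * metric_deriv v t)) (at t) \<and>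
      ?G powr conj_exp p = ?G * metric_deriv v t \<and> metric_deriv v t powr p = ?G * metric_deriv v t"
      by auto
  qed
qed

lemma gradient_flow_energy_identity:
  fixes v :: "real \<Rightarrow> 'a::metric_space"
  assumes p: "1 < p" and sug: "strong_upper_gradient E g" and flow: "gradient_flow p E g v"
  shows "AE t in lborel. 0 < t \<longrightarrow> g (v t) < \<infinity> \<and> 0 \<le> metric_deriv v t \<and>
    ((\<lambda>s. real_of_ereal (E (v s))) has_real_derivative - (enn2real (g (v t)) * metric_deriv v t)) (at t) \<and>
    enn2real (g (v t)) powr conj_exp p = enn2real (g (v t)) * metric_deriv v t \<and>
    metric_deriv v t powr p = enn2real (g (v t)) * metric_deriv v t" (is "AE t in lborel. 0 < t \<longrightarrow> ?P t")
proof -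
  \<comment> \<open>Adding 2 rather than 1 makes the left end point strictly smaller than the right
    one already for n = 0.\<close>
  have "AE t in lborel. \<forall>n::nat. 1 / (real n + 2) < t \<and> t < real n + 2 \<longrightarrow> ?P t"
    unfolding AE_all_countable
  proof
    fix n :: nat
    have "1 / (real n + 2) < 1" "1 < real n + 2" by auto
    then have "1 / (real n + 2) < real n + 2" by linarith
    then show "AE t in lborel. 1 / (real n + 2) < t \<and> t < real n + 2 \<longrightarrow> ?P t"
      by (intro gradient_flow_energy_identity_on[OF p sug flow]) auto
  qed
  then show ?thesis
  proof (eventually_elim, intro impI)
    fix t :: real
    assume *: "\<forall>n::nat. 1 / (real n + 2) < t \<and> t < real n + 2 \<longrightarrow> ?P t" and t: "0 < t"
    obtain n :: nat where n: "max t (1 / t) < real n"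
      using reals_Archimedean2 by blast
    then have "1 / t < real n + 2" "t < real n + 2" by auto
    with t have "1 / (real n + 2) < t \<and> t < real n + 2"
      by (auto simp: field_simps)
    with * show "?P t" by blast
  qed
qed

subsection \<open>Lojasiewicz-Simon estimates\<close>

text \<open>Lower semicontinuity is available only on the closure of a tail of the curve, which
  suffices because the points approximating \<open>\<phi>\<close> lie in it. If E (v t) were below
  \<open>E \<phi>\<close>, the energy would exceed E (v t) near \<open>\<phi>\<close>, against its
  decrease along the curve.\<close>

lemma energy_ge_limit:
  fixes E :: "'a::metric_space \<Rightarrow> ereal"
  assumes antimono: "\<And>s t. 0 < s \<Longrightarrow> s \<le> t \<Longrightarrow> E (v t) \<le> E (v s)"
    and lsc: "lsc_on (closure (v ` {T..})) E"
    and \<phi>: "\<phi> \<in> omega_limit v" and t: "0 < t"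
  shows "E \<phi> \<le> E (v t)"
proof (rule ccontr)
  assume "\<not> E \<phi> \<le> E (v t)"
  then have less: "E (v t) < E \<phi>" by simp
  let ?S = "closure (v ` {T..})"
  from \<phi> obtain u :: "nat \<Rightarrow> real" where u: "filterlim u at_top sequentially" "(\<lambda>n. v (u n)) \<longlonglongrightarrow> \<phi>"
    unfolding omega_limit_def by blast
  have ev: "\<forall>\<^sub>F n in sequentially. max t T \<le> u n"
    using u(1) unfolding filterlim_at_top by blast
  have in_S: "\<forall>\<^sub>F n in sequentially. v (u n) \<in> ?S"
    using ev by eventually_elim (auto intro!: subsetD[OF closure_subset])
  have "\<phi> \<in> ?S"
    by (rule Lim_in_closed_set[OF _ in_S _ u(2)]) auto
  then have "E \<phi> \<le> Liminf (at \<phi> within ?S) E"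
    using lsc by (auto simp: lsc_on_def)
  with less have "\<forall>\<^sub>F x in at \<phi> within ?S. E (v t) < E x"
    by (auto simp: le_Liminf_iff)
  moreover have "filterlim (\<lambda>n. v (u n)) (at \<phi> within ?S) sequentially"
    unfolding filterlim_at
  proof (intro conjI u(2))
    \<comment> \<open>The punctured filter at \<open>\<phi>\<close> admits only points other than
      \<open>\<phi>\<close>; late points of the curve qualify, having energy below
      \<open>E \<phi>\<close>.\<close>
    show "\<forall>\<^sub>F n in sequentially. v (u n) \<in> ?S \<and> v (u n) \<noteq> \<phi>"
      using ev in_S
    proof eventually_elim
      case (elim n)
      then have "E (v (u n)) \<le> E (v t)" using t by (intro antimono) auto
      with less elim show ?case by auto
    qed
  qed
  ultimately have "\<forall>\<^sub>F n in sequentially. E (v t) < E (v (u n))"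
    by (auto simp: filterlim_iff)
  with ev have "\<forall>\<^sub>F n in sequentially. False"
  proof eventually_elim
    case (elim n)
    then have "E (v (u n)) \<le> E (v t)" using t by (intro antimono) auto
    with elim show ?case by auto
  qed
  then show False by simp
qed

section \<open>The flow under the Lojasiewicz-Simon inequality\<close>

text \<open>\<open>E_ge\<close> is the form in which lower semicontinuity enters, and
  \<open>E_\<phi>\<close> the form in which \<open>g \<phi> = 0\<close> enters. With both, the
  relative energy along the flow is a nonnegative real at positive times.\<close>

locale Lojasiewicz_flow =
  fixes E :: "'a::metric_space \<Rightarrow> ereal" and g :: "'a \<Rightarrow> ennreal" and v :: "real \<Rightarrow> 'a"
    and \<phi> :: 'a and p \<epsilon> c \<alpha> :: real
  assumes p: "1 < p" and E_minf: "\<And>u. E u \<noteq> -\<infinity>"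
    and sug: "strong_upper_gradient E g" and flow: "gradient_flow p E g v"
    and E_\<phi>: "E \<phi> < \<infinity>" and \<epsilon>: "0 < \<epsilon>" and c: "0 < c" and \<alpha>: "0 < \<alpha>" "\<alpha> \<le> 1"
    and LS: "LS_inequality E g \<phi> \<epsilon> c \<alpha>"
    and E_ge: "\<And>t. 0 < t \<Longrightarrow> E \<phi> \<le> E (v t)"
begin

definition e :: "real \<Rightarrow> real" where "e t = rel_energy E (v t) \<phi>"
definition H :: "real \<Rightarrow> real" where "H t = c / \<alpha> * e t powr \<alpha>"
definition G :: "real \<Rightarrow> real" where "G t = enn2real (g (v t))"
text \<open>The ball is asked for only after \<open>s\<close>, because at the infimum of the entry
  times the curve may still lie outside. At time 0 the flow guarantees nothing by itself, hence the
  extra condition there.\<close>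

definition start :: "real \<Rightarrow> bool" where
  "start s \<longleftrightarrow> 0 \<le> s \<and> (s = 0 \<longrightarrow> regular_at_zero E v) \<and> (\<forall>r>s. v r \<in> ball \<phi> \<epsilon>)"

lemma E_flow_fin: "0 < t \<Longrightarrow> \<bar>E (v t)\<bar> \<noteq> \<infinity>"
  using flow by (simp add: gradient_flow_def)

lemma E_flow_antimono: "0 < s \<Longrightarrow> s \<le> t \<Longrightarrow> E (v t) \<le> E (v s)"
  using flow by (simp add: gradient_flow_def)

lemma e_eq: "\<bar>E (v t)\<bar> \<noteq> \<infinity> \<Longrightarrow> e t = real_of_ereal (E (v t)) - real_of_ereal (E \<phi>)"
  using E_\<phi> E_minf[of \<phi>] unfolding e_def rel_energy_def
  by (cases "E (v t)"; cases "E \<phi>") auto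

lemma e_le_iff: "\<bar>E (v s)\<bar> \<noteq> \<infinity> \<Longrightarrow> \<bar>E (v t)\<bar> \<noteq> \<infinity> \<Longrightarrow> e t \<le> e s \<longleftrightarrow> E (v t) \<le> E (v s)"
  by (cases "E (v s)"; cases "E (v t)") (auto simp: e_eq)

lemma e_nonneg_iff: "\<bar>E (v t)\<bar> \<noteq> \<infinity> \<Longrightarrow> 0 \<le> e t \<longleftrightarrow> E \<phi> \<le> E (v t)"
  using E_\<phi> E_minf[of \<phi>] by (cases "E (v t)"; cases "E \<phi>") (auto simp: e_eq)

lemma E_fin_start: "start s \<Longrightarrow> s \<le> t \<Longrightarrow> \<bar>E (v t)\<bar> \<noteq> \<infinity>"
  using E_flow_fin[of t] E_minf[of "v 0"]
  by (cases "t = 0") (auto simp: start_def regular_at_zero_def)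

lemma E_ge_start: "start s \<Longrightarrow> s \<le> t \<Longrightarrow> E \<phi> \<le> E (v t)"
  using E_ge[of t] order_trans[OF E_ge[of 1], of "E (v 0)"]
  by (cases "t = 0") (auto simp: start_def regular_at_zero_def)

lemma e_antimono_start:
  assumes "start s" "s \<le> r" "r \<le> t"
  shows "e t \<le> e r"
proof -
  have "E (v t) \<le> E (v r)"
  proof (cases "r = 0")
    case True
    then show ?thesis
      using assms by (cases "t = 0") (auto simp: start_def regular_at_zero_def)
  next
    case False
    then show ?thesis
      using assms by (intro E_flow_antimono) (auto simp: start_def)
  qed
  then show ?thesis
    using e_le_iff[OF E_fin_start E_fin_start] assms by (meson order_trans)
qed

lemma e_antimono: "0 < s \<Longrightarrow> s \<le> t \<Longrightarrow> e t \<le> e s"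
  by (rule e_le_iff[THEN iffD2, OF E_flow_fin E_flow_fin E_flow_antimono]) auto

lemma e_nonneg: "0 < t \<Longrightarrow> 0 \<le> e t"
  by (rule e_nonneg_iff[THEN iffD2, OF E_flow_fin E_ge])

lemma H_antimono: "0 < s \<Longrightarrow> s \<le> t \<Longrightarrow> H t \<le> H s"
  using c \<alpha> unfolding H_def by (intro mult_left_mono powr_mono2 e_antimono e_nonneg) auto

lemma H_nonneg: "0 \<le> H t"
  using c \<alpha> by (simp add: H_def)

section \<open>Length estimates inside the ball\<close>

lemma AE_flow:
  "AE t in lborel. 0 < t \<and> v t \<in> ball \<phi> \<epsilon> \<longrightarrow> 0 \<le> metric_deriv v t \<and>
    (e has_real_derivative - (G t * metric_deriv v t)) (at t) \<and>
    G t powr conj_exp p = G t * metric_deriv v t \<and> metric_deriv v t powr p = G t * metric_deriv v t \<and>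
    e t powr (1 - \<alpha>) \<le> c * G t"
  using gradient_flow_energy_identity[OF p sug flow]
proof (eventually_elim, intro impI)
  fix t
  let ?D = "- (enn2real (g (v t)) * metric_deriv v t)"
  assume *: "0 < t \<longrightarrow> g (v t) < \<infinity> \<and> 0 \<le> metric_deriv v t \<and>
      ((\<lambda>s. real_of_ereal (E (v s))) has_real_derivative ?D) (at t) \<and>
      enn2real (g (v t)) powr conj_exp p = enn2real (g (v t)) * metric_deriv v t \<and>
      metric_deriv v t powr p = enn2real (g (v t)) * metric_deriv v t"
    and t: "0 < t \<and> v t \<in> ball \<phi> \<epsilon>"
  have "((\<lambda>s. real_of_ereal (E (v s)) - real_of_ereal (E \<phi>)) has_real_derivative ?D) (at t)"
    using * t by (auto intro!: derivative_eq_intros)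
  moreover have "\<forall>\<^sub>F s in nhds t. s \<in> {0<..}"
    using t by (intro eventually_nhds_in_open) auto
  then have "\<forall>\<^sub>F s in nhds t. real_of_ereal (E (v s)) - real_of_ereal (E \<phi>) = e s"
    by eventually_elim (simp add: e_eq E_flow_fin)
  ultimately have "(e has_real_derivative ?D) (at t)"
    by (subst (asm) DERIV_cong_ev) auto
  moreover have "e t powr (1 - \<alpha>) \<le> c * G t"
  proof -
    have "v t \<in> eff_domain E"
      using E_flow_fin[of t] t by (auto simp: eff_domain_def)
    with LS t have "ennreal (\<bar>e t\<bar> powr (1 - \<alpha>)) \<le> ennreal c * g (v t)"
      unfolding LS_inequality_def e_def by blast
    also have "g (v t) = ennreal (G t)"
      using * t by (simp add: G_def less_top)
    finally show ?thesis
      using c t e_nonneg[of t] by (simp add: ennreal_mult[symmetric] G_def)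
  qed
  ultimately show "0 \<le> metric_deriv v t \<and>
    (e has_real_derivative - (G t * metric_deriv v t)) (at t) \<and>
    G t powr conj_exp p = G t * metric_deriv v t \<and> metric_deriv v t powr p = G t * metric_deriv v t \<and>
    e t powr (1 - \<alpha>) \<le> c * G t"
    using * t by (auto simp: G_def)
qed

text \<open>
  \<open>H\<close> need not be differentiable where \<open>e\<close> reaches \<open>0\<close>. The zero set of \<open>e\<close> is a half-line, so this
  concerns a single time; in its interior the derivative \<open>D\<close> of \<open>- H\<close> is \<open>0\<close> because \<open>0 powr (\<alpha> - 1) = 0\<close>.
\<close>

lemma dist_le_H_diff:
  assumes st: "0 < s" "s \<le> t" and ball: "\<And>r. s < r \<Longrightarrow> r < t \<Longrightarrow> v r \<in> ball \<phi> \<epsilon>"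
  shows "dist (v s) (v t) \<le> H s - H t"
proof -
  define D where "D r = c * e r powr (\<alpha> - 1) * (G r * metric_deriv v r)" for r
  \<comment> \<open>If \<open>Z\<close> is empty, \<open>Inf Z\<close> is some unspecified real, and
    discarding one time costs nothing.\<close>
  define Z where "Z = {r. s < r \<and> e r = 0}"
  have bdd: "bdd_below Z"
    by (intro bdd_belowI[of _ s]) (auto simp: Z_def)
  have "AE r in lborel. s < r \<and> r < t \<longrightarrow> metric_deriv v r \<le> D r \<and> (H has_real_derivative - D r) (at r)"
    using AE_flow AE_lborel_singleton[of "Inf Z"]
  proof (eventually_elim, intro impI)
    fix r
    assume *: "0 < r \<and> v r \<in> ball \<phi> \<epsilon> \<longrightarrow> 0 \<le> metric_deriv v r \<and>
        (e has_real_derivative - (G r * metric_deriv v r)) (at r) \<and>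
        G r powr conj_exp p = G r * metric_deriv v r \<and> metric_deriv v r powr p = G r * metric_deriv v r \<and>
        e r powr (1 - \<alpha>) \<le> c * G r"
      and r: "r \<noteq> Inf Z" "s < r \<and> r < t"
    with ball st have md: "0 \<le> metric_deriv v r"
      and e': "(e has_real_derivative - (G r * metric_deriv v r)) (at r)"
      and md_p: "metric_deriv v r powr p = G r * metric_deriv v r"
      and LS_r: "e r powr (1 - \<alpha>) \<le> c * G r"
      by auto
    show "metric_deriv v r \<le> D r \<and> (H has_real_derivative - D r) (at r)"
    proof (cases "0 < e r")
      case True
      have "1 = e r powr (\<alpha> - 1) * e r powr (1 - \<alpha>)"
        using True by (simp add: powr_add[symmetric])
      also have "\<dots> \<le> e r powr (\<alpha> - 1) * (c * G r)"
        using LS_r by (intro mult_left_mono) auto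
      finally have "1 * metric_deriv v r \<le> (e r powr (\<alpha> - 1) * (c * G r)) * metric_deriv v r"
        using md by (intro mult_right_mono) auto
      moreover have "((\<lambda>r. e r powr \<alpha>) has_real_derivative
          (\<alpha> * e r powr (\<alpha> - 1)) * (- (G r * metric_deriv v r))) (at r)"
        by (rule DERIV_chain2[OF has_real_derivative_powr[OF True] e'])
      then have "(H has_real_derivative c / \<alpha> * ((\<alpha> * e r powr (\<alpha> - 1)) * (- (G r * metric_deriv v r)))) (at r)"
        unfolding H_def by (rule DERIV_cmult)
      ultimately show ?thesis
        using \<alpha> by (simp add: D_def mult_ac)
    next
      case False
      have e_r: "e r = 0"
        using False e_nonneg[of r] r st by simp
      then have "r \<in> Z" using r by (simp add: Z_def)
      then have "Inf Z < r"
        using cInf_lower[OF _ bdd] r by fastforce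
      then obtain z where z: "z \<in> Z" "z < r"
        using cInf_lessD[of Z r] \<open>r \<in> Z\<close> by blast
      have "\<forall>\<^sub>F x in nhds r. x \<in> {z<..}"
        using z by (intro eventually_nhds_in_open) auto
      then have ev: "\<forall>\<^sub>F x in nhds r. e x = 0"
      proof eventually_elim
        case (elim x)
        then show ?case
          using z st e_antimono[of z x] e_nonneg[of x] by (auto simp: Z_def)
      qed
      then have "(e has_real_derivative 0) (at r)"
        by (subst DERIV_cong_ev[OF refl _ refl]) auto
      \<comment> \<open>The energy identity turns a vanishing derivative of \<open>e\<close> into a
        vanishing speed.\<close>
      then have "metric_deriv v r powr p = 0"
        using e' md_p DERIV_unique by fastforce
      then have "metric_deriv v r = 0" by simp
      moreover have "\<forall>\<^sub>F x in nhds r. H x = 0"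
        using ev by eventually_elim (simp add: H_def)
      then have "(H has_real_derivative 0) (at r)"
        by (subst DERIV_cong_ev[OF refl _ refl]) auto
      ultimately show ?thesis by (simp add: D_def)
    qed
  qed
  note D = this
  have "AC_loc 0 \<infinity> v" using flow by (simp add: gradient_flow_def)
  from AC_loc_metric_deriv[OF this, of s t] st
  have "ennreal (dist (v s) (v t)) \<le> (\<integral>\<^sup>+r\<in>{s..t}. ennreal (metric_deriv v r) \<partial>lborel)"
    by auto
  also have "\<dots> \<le> (\<integral>\<^sup>+r\<in>{s..t}. ennreal (D r) \<partial>lborel)"
    using D AE_lborel_singleton[of s] AE_lborel_singleton[of t]
    by (intro nn_integral_mono_AE, eventually_elim) (auto simp: indicator_def intro: ennreal_leI)
  also have "\<dots> \<le> ennreal (- H t - - H s)"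
  proof (rule nn_integral_DERIV_mono_le[OF st(2)])
    show "mono_on {s..t} (\<lambda>r. - H r)"
      using st by (auto intro!: mono_onI H_antimono)
    show "AE r in lborel. s < r \<and> r < t \<longrightarrow> ((\<lambda>r. - H r) has_real_derivative D r) (at r)"
      using D by eventually_elim (auto dest: DERIV_minus)
  qed
  finally show ?thesis
    using H_antimono[OF st] by simp
qed

text \<open>Convergence along one sequence is enough: the distance from v t to v (u n) is at most H
  t - H (u n) \<le> H t, and this passes to the limit. Since \<open>dist_le_H_diff\<close> starts at
  positive times, t = 0 is reached from the right.\<close>

lemma dist_limit_le_H:
  assumes \<phi>: "\<phi> \<in> omega_limit v" and s: "start s" "s \<le> t"
  shows "dist (v t) \<phi> \<le> H t"
proof -
  from \<phi> obtain u :: "nat \<Rightarrow> real" where u: "filterlim u at_top sequentially" "(\<lambda>n. v (u n)) \<longlonglongrightarrow> \<phi>"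
    unfolding omega_limit_def by blast
  have pos: "dist (v t) \<phi> \<le> H t" if t: "s \<le> t" "0 < t" for t
  proof (rule tendsto_upperbound)
    show "(\<lambda>n. dist (v t) (v (u n))) \<longlonglongrightarrow> dist (v t) \<phi>"
      by (intro tendsto_intros u(2))
    have "\<forall>\<^sub>F n in sequentially. t \<le> u n"
      using u(1) unfolding filterlim_at_top by blast
    then show "\<forall>\<^sub>F n in sequentially. dist (v t) (v (u n)) \<le> H t"
    proof eventually_elim
      case (elim n)
      have "dist (v t) (v (u n)) \<le> H t - H (u n)"
        using t elim s by (intro dist_le_H_diff) (auto simp: start_def)
      with H_nonneg[of "u n"] show ?case by simp
    qed
  qed simp
  show ?thesis
  proof (cases "t = 0")
    case True
    with s have reg: "regular_at_zero E v" and "s = 0" by (auto simp: start_def)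
    have "dist (v 0) \<phi> \<le> H 0"
    proof (rule tendsto_upperbound)
      show "((\<lambda>r. dist (v r) \<phi>) \<longlongrightarrow> dist (v 0) \<phi>) (at_right 0)"
        using reg by (intro tendsto_intros) (auto simp: regular_at_zero_def)
      have "\<forall>\<^sub>F r in at_right 0. (0::real) < r"
        by (simp add: eventually_at_right_less)
      then show "\<forall>\<^sub>F r in at_right 0. dist (v r) \<phi> \<le> H 0"
      proof eventually_elim
        case (elim r)
        have "e r \<le> e 0" using s elim True by (intro e_antimono_start) auto
        then have "H r \<le> H 0"
          using c \<alpha> elim unfolding H_def by (intro mult_left_mono powr_mono2 e_nonneg) auto
        with pos[of r] elim \<open>s = 0\<close> show ?case by simp
      qed
    qed simp
    with True show ?thesis by simp
  next
    case False
    with s show ?thesis by (intro pos) (auto simp: start_def)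
  qed
qed

text \<open>The length bound presupposes that the curve stays in the ball, which is the very claim.
  The first exit time breaks the circle: \<open>dist_le_H_diff\<close> asks for the ball only
  strictly between its end points, so it applies up to the exit and shows the exit point to be
  inside after all.\<close>

lemma entry_times_nonempty:
  assumes \<phi>: "\<phi> \<in> omega_limit v"
  shows "entry_times v \<phi> \<epsilon> \<noteq> {}"
proof -
  from \<phi> obtain u :: "nat \<Rightarrow> real" where u: "filterlim u at_top sequentially" "(\<lambda>n. v (u n)) \<longlonglongrightarrow> \<phi>"
    unfolding omega_limit_def by blast
  \<comment> \<open>Once H is below L + \<epsilon> / 2, less than \<epsilon> / 2 of displacement
    remains; the other half of \<epsilon> goes to the distance between v a and
    \<open>\<phi>\<close>.\<close>
  define L where "L = Inf (H ` {0<..})"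
  have bdd: "bdd_below (H ` {0<..})"
    by (intro bdd_belowI[of _ 0]) (auto intro: H_nonneg)
  have "Inf (H ` {0<..}) < L + \<epsilon> / 2"
    using \<epsilon> by (simp add: L_def)
  then obtain r where r: "0 < r" "H r < L + \<epsilon> / 2"
    using cInf_lessD[of "H ` {0<..}"] by auto
  have "\<forall>\<^sub>F n in sequentially. r \<le> u n"
    using u(1) unfolding filterlim_at_top by blast
  moreover have "\<forall>\<^sub>F n in sequentially. dist (v (u n)) \<phi> < \<epsilon> / 2"
    using tendstoD[OF u(2), of "\<epsilon> / 2"] \<epsilon> by simp
  ultimately have "\<forall>\<^sub>F n in sequentially. r \<le> u n \<and> dist (v (u n)) \<phi> < \<epsilon> / 2"
    by eventually_elim simp
  then obtain n where n: "r \<le> u n" "dist (v (u n)) \<phi> < \<epsilon> / 2"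
    by (auto dest: eventually_happens)
  define a where "a = u n"
  have a: "0 < a" "dist (v a) \<phi> < \<epsilon> / 2" "H a < L + \<epsilon> / 2"
    using n r H_antimono[of r "u n"] by (auto simp: a_def)
  have "dist (v t) \<phi> < \<epsilon>" if t: "a \<le> t" for t
  proof (rule ccontr)
    assume "\<not> dist (v t) \<phi> < \<epsilon>"
    define A where "A = {x \<in> {a..t}. \<epsilon> \<le> dist (v x) \<phi>}"
    have "t \<in> A" using t \<open>\<not> _\<close> by (auto simp: A_def)
    have cont: "continuous_on {a..t} v"
    proof (rule continuous_on_subset[OF AC_loc_continuous_on])
      show "AC_loc 0 \<infinity> v" using flow by (simp add: gradient_flow_def)
      show "{a..t} \<subseteq> {t. 0 < ereal t}" using a by auto
    qed
    have "closed A"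
    proof -
      have "closed ({a..t} \<inter> (\<lambda>x. dist (v x) \<phi>) -` {\<epsilon>..})"
        by (intro continuous_closed_preimage continuous_intros cont closed_atLeastAtMost closed_atLeast)
      also have "{a..t} \<inter> (\<lambda>x. dist (v x) \<phi>) -` {\<epsilon>..} = A"
        by (auto simp: A_def)
      finally show ?thesis .
    qed
    moreover have "bdd_below A" by (auto simp: A_def)
    ultimately have T: "Inf A \<in> A"
      using \<open>t \<in> A\<close> by (intro closed_contains_Inf) auto
    have "dist (v a) (v (Inf A)) \<le> H a - H (Inf A)"
    proof (rule dist_le_H_diff)
      show "v r \<in> ball \<phi> \<epsilon>" if "a < r" "r < Inf A" for r
      proof (rule ccontr)
        assume "v r \<notin> ball \<phi> \<epsilon>"
        with that T have "r \<in> A" by (auto simp: A_def dist_commute)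
        with that cInf_lower[OF this \<open>bdd_below A\<close>] show False by simp
      qed
    qed (use a T in \<open>auto simp: A_def\<close>)
    moreover have "L \<le> H (Inf A)"
      unfolding L_def using a T by (intro cInf_lower bdd imageI) (auto simp: A_def)
    ultimately have "dist (v (Inf A)) \<phi> < \<epsilon>"
      using a dist_triangle[of "v (Inf A)" \<phi> "v a"] by (simp add: dist_commute)
    with T show False by (simp add: A_def)
  qed
  then have "a \<in> entry_times v \<phi> \<epsilon>"
    using a by (auto simp: entry_times_def dist_commute)
  then show ?thesis by blast
qed

lemma start_first_entry_time:
  assumes \<phi>: "\<phi> \<in> omega_limit v" and s: "first_entry_time v \<phi> \<epsilon> \<le> s" "s = 0 \<longrightarrow> regular_at_zero E v"
  shows "start s"
proof -
  note ne = entry_times_nonempty[OF \<phi>]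
  have "0 \<le> first_entry_time v \<phi> \<epsilon>"
    unfolding first_entry_time_def using ne by (intro cInf_greatest) (auto simp: entry_times_def)
  moreover have "v r \<in> ball \<phi> \<epsilon>" if "s < r" for r
  proof -
    have "Inf (entry_times v \<phi> \<epsilon>) < r" using s that by (simp add: first_entry_time_def)
    then obtain x where "x \<in> entry_times v \<phi> \<epsilon>" "x < r"
      using cInf_lessD[OF ne] by blast
    then have "v r \<in> v ` {x..}" by simp
    with \<open>x \<in> _\<close> show ?thesis by (auto simp: entry_times_def)
  qed
  ultimately show ?thesis using s by (auto simp: start_def)
qed

section \<open>Separation of variables and decay rates\<close>

text \<open>\<open>\<Theta>\<close> is kept abstract so that powers and the logarithm are treated at
  once. By Lojasiewicz-Simon the derivative of - \<open>\<Theta>\<close> along \<open>e\<close> is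
  at least c powr (- q), with q the conjugate exponent. Positivity of \<open>e t\<close> propagates
  back to all of [s, t], so that \<open>\<Theta>\<close> is evaluated only at positive
  arguments.\<close>

lemma energy_separation:
  assumes s: "start s" "s \<le> t" and pos: "0 < e t"
    and \<Theta>: "\<And>x. 0 < x \<Longrightarrow> (\<Theta> has_real_derivative x powr (- ((1 - \<alpha>) * conj_exp p))) (at x)"
  shows "(t - s) / c powr conj_exp p \<le> \<Theta> (e s) - \<Theta> (e t)"
proof -
  define q where "q = conj_exp p"
  have q: "0 < q" using p by (simp add: q_def conj_exp_def)
  define \<theta> where "\<theta> x = x powr (- ((1 - \<alpha>) * q))" for x :: real
  have \<Theta>_mono: "\<Theta> x \<le> \<Theta> y" if "0 < x" "x \<le> y" for x y
  proof (rule DERIV_nonneg_imp_nondecreasing[OF that(2)])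
    fix z assume "x \<le> z" "z \<le> y"
    then show "\<exists>D. (\<Theta> has_real_derivative D) (at z) \<and> 0 \<le> D"
      using \<Theta>[of z] that by (intro exI[of _ "z powr (- ((1 - \<alpha>) * conj_exp p))"]) auto
  qed
  have e_pos: "0 < e r" if "s \<le> r" "r \<le> t" for r
    using pos e_antimono_start[OF s(1) that] by linarith
  have mono: "mono_on {s..t} (\<lambda>r. - \<Theta> (e r))"
    using s by (auto intro!: mono_onI \<Theta>_mono e_pos e_antimono_start)
  have deriv: "AE r in lborel. s < r \<and> r < t \<longrightarrow> 1 / c powr q \<le> \<theta> (e r) * G r powr q \<and>
      ((\<lambda>r. - \<Theta> (e r)) has_real_derivative \<theta> (e r) * G r powr q) (at r)"
    using AE_flow
  proof (eventually_elim, intro impI)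
    fix r
    assume *: "0 < r \<and> v r \<in> ball \<phi> \<epsilon> \<longrightarrow> 0 \<le> metric_deriv v r \<and>
        (e has_real_derivative - (G r * metric_deriv v r)) (at r) \<and>
        G r powr conj_exp p = G r * metric_deriv v r \<and> metric_deriv v r powr p = G r * metric_deriv v r \<and>
        e r powr (1 - \<alpha>) \<le> c * G r"
      and r: "s < r \<and> r < t"
    with s have e': "(e has_real_derivative - (G r powr q)) (at r)" and LS_r: "e r powr (1 - \<alpha>) \<le> c * G r"
      by (auto simp: start_def q_def)
    have er: "0 < e r" using r by (intro e_pos) auto
    have "e r powr ((1 - \<alpha>) * q) \<le> c powr q * G r powr q"
    proof -
      have "(e r powr (1 - \<alpha>)) powr q \<le> (c * G r) powr q"
        using LS_r q by (intro powr_mono2) auto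
      then show ?thesis
        using c by (simp add: powr_powr powr_mult G_def)
    qed
    then have "\<theta> (e r) * e r powr ((1 - \<alpha>) * q) \<le> \<theta> (e r) * (c powr q * G r powr q)"
      by (intro mult_left_mono) (auto simp: \<theta>_def)
    moreover have "\<theta> (e r) * e r powr ((1 - \<alpha>) * q) = 1"
      using er by (simp add: \<theta>_def powr_add[symmetric])
    ultimately have "1 / c powr q \<le> \<theta> (e r) * G r powr q"
      using c by (simp add: field_simps)
    moreover have "((\<lambda>r. - \<Theta> (e r)) has_real_derivative \<theta> (e r) * G r powr q) (at r)"
      using DERIV_minus[OF DERIV_chain2[OF \<Theta>[OF er] e']] by (simp add: \<theta>_def q_def)
    ultimately show "1 / c powr q \<le> \<theta> (e r) * G r powr q \<and>
      ((\<lambda>r. - \<Theta> (e r)) has_real_derivative \<theta> (e r) * G r powr q) (at r)" by simp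
  qed
  have "ennreal ((t - s) / c powr q) = (\<integral>\<^sup>+r\<in>{s..t}. ennreal (1 / c powr q) \<partial>lborel)"
    using s c by (simp add: nn_integral_cmult_indicator ennreal_mult[symmetric])
  also have "\<dots> \<le> (\<integral>\<^sup>+r\<in>{s..t}. ennreal (\<theta> (e r) * G r powr q) \<partial>lborel)"
    using deriv AE_lborel_singleton[of s] AE_lborel_singleton[of t]
    by (intro nn_integral_mono_AE, eventually_elim) (auto simp: indicator_def intro: ennreal_leI)
  also have "\<dots> \<le> ennreal (- \<Theta> (e t) - - \<Theta> (e s))"
    by (rule nn_integral_DERIV_mono_le[OF s(2) mono]) (use deriv in \<open>eventually_elim, auto\<close>)
  finally show ?thesis
    using \<Theta>_mono[OF pos e_antimono_start[OF s(1) _ s(2)]] by (simp add: q_def)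
qed

text \<open>The sign of 1 - \<beta> decides the regime: it is negative for \<alpha> < 1 / p, where
  the power of \<open>e\<close> grows as \<open>e\<close> decays, and positive for \<alpha> > 1 / p,
  where the power falls to 0 in finite time. The value 0 belongs to \<alpha> = 1 / p and to the
  logarithm.\<close>

lemma energy_separation_powr:
  assumes s: "start s" "s \<le> t" and pos: "0 < e t" and \<beta>: "\<beta> = (1 - \<alpha>) * conj_exp p" "\<beta> \<noteq> 1"
  shows "(t - s) / c powr conj_exp p \<le> (e s powr (1 - \<beta>) - e t powr (1 - \<beta>)) / (1 - \<beta>)"
proof -
  have "(t - s) / c powr conj_exp p \<le> e s powr (1 - \<beta>) / (1 - \<beta>) - e t powr (1 - \<beta>) / (1 - \<beta>)"
  proof (rule energy_separation[OF s pos, where \<Theta> = "\<lambda>x. x powr (1 - \<beta>) / (1 - \<beta>)"])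
    fix x :: real assume "0 < x"
    from DERIV_cdivide[OF has_real_derivative_powr[OF this, of "1 - \<beta>"], of "1 - \<beta>"] \<beta>
    show "((\<lambda>x. x powr (1 - \<beta>) / (1 - \<beta>)) has_real_derivative x powr - ((1 - \<alpha>) * conj_exp p)) (at x)"
      by simp
  qed
  then show ?thesis by (simp add: diff_divide_distrib)
qed

text \<open>At this exponent the primitive is \<open>ln\<close>. Distances are controlled by the
  p-th root of \<open>e\<close>, so the logarithmic bound is divided by p, which puts the factor p
  into the rate.\<close>

lemma energy_exponential_decay:
  assumes s: "start s" "s \<le> t" and \<alpha>_eq: "\<alpha> = 1 / p"
  shows "e t powr (1 / p) \<le> e s powr (1 / p) * exp (- ((t - s) / (p * c powr conj_exp p)))"
proof (cases "0 < e t")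
  case True
  have es: "0 < e s" using True e_antimono_start[OF s(1) _ s(2)] by simp
  have "(t - s) / c powr conj_exp p \<le> ln (e s) - ln (e t)"
  proof (rule energy_separation[OF s True])
    fix x :: real assume x: "0 < x"
    have "(1 - \<alpha>) * conj_exp p = 1"
      using p by (simp add: \<alpha>_eq conj_exp_def field_simps)
    with DERIV_ln_divide[OF x] x show "(ln has_real_derivative x powr - ((1 - \<alpha>) * conj_exp p)) (at x)"
      by (simp add: powr_minus_divide)
  qed
  then have "ln (e t) / p \<le> (ln (e s) - (t - s) / c powr conj_exp p) / p"
    using p by (intro divide_right_mono) auto
  then have "ln (e t) / p \<le> ln (e s) / p - (t - s) / c powr conj_exp p / p"
    by (simp only: diff_divide_distrib)
  then have "exp (ln (e t) / p) \<le> exp (ln (e s) / p - (t - s) / c powr conj_exp p / p)"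
    by simp
  also have "\<dots> = exp (ln (e s) / p) * exp (- ((t - s) / (p * c powr conj_exp p)))"
    by (simp add: exp_add[symmetric] mult.commute)
  finally show ?thesis
    using True es by (simp add: powr_def)
next
  case False
  then have "e t = 0"
    using s E_fin_start[OF s] E_ge_start[OF s] e_nonneg_iff[of t] by auto
  then show ?thesis using p by simp
qed

text \<open>Here \<open>e\<close> raised to - b grows at least linearly in time, and inverting that
  power yields the rate. The contribution of \<open>e s\<close> is dropped, so the constant does not
  depend on the initial energy.\<close>

lemma energy_polynomial_decay:
  assumes s: "start s" and \<alpha>_less: "\<alpha> < 1 / p"
  shows "H \<in> O(\<lambda>t. t powr (- (\<alpha> * (p - 1) / (1 - p * \<alpha>))))"
proof -
  define b where "b = (1 - \<alpha>) * conj_exp p - 1"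
  \<comment> \<open>The factor 1 / 2 pays for replacing t - s by t, as t - s \<ge> t / 2 once t
    \<ge> 2 * s.\<close>
  define k where "k = b / c powr conj_exp p / 2"
  have b_eq: "b = (1 - p * \<alpha>) / (p - 1)"
    using p by (simp add: b_def conj_exp_def field_simps)
  have b: "0 < b" using \<alpha>_less p by (simp add: b_eq field_simps)
  have k: "0 < k" using b c by (simp add: k_def)
  have exponent: "\<alpha> * (p - 1) / (1 - p * \<alpha>) = \<alpha> / b"
    by (simp add: b_eq)
  define C where "C = c / \<alpha> * k powr (- (\<alpha> / b))"
  have s0: "0 \<le> s" using s by (simp add: start_def)
  show ?thesis
  proof (rule bigoI[where c = C])
    have "\<forall>\<^sub>F t in at_top. max (2 * s) 1 \<le> t"
      by (rule eventually_ge_at_top)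
    then show "\<forall>\<^sub>F t in at_top. norm (H t) \<le> C * norm (t powr (- (\<alpha> * (p - 1) / (1 - p * \<alpha>))))"
    proof eventually_elim
      case (elim t)
      then have t: "0 < t" "s \<le> t" "t / 2 \<le> t - s" using s0 by auto
      have "e t powr \<alpha> \<le> k powr (- (\<alpha> / b)) * t powr (- (\<alpha> / b))"
      proof (cases "0 < e t")
        case True
        have "1 - (1 - \<alpha>) * conj_exp p = - b" "(1 - \<alpha>) * conj_exp p \<noteq> 1"
          using b by (auto simp: b_def)
        with energy_separation_powr[OF s t(2) True refl]
        have "(t - s) / c powr conj_exp p \<le> (e s powr (- b) - e t powr (- b)) / (- b)"
          by simp
        also have "\<dots> = (e t powr (- b) - e s powr (- b)) / b"
          by (metis minus_diff_eq minus_divide_divide)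
        also have "\<dots> \<le> e t powr (- b) / b"
          using b by (intro divide_right_mono) auto
        finally have "b / c powr conj_exp p * (t - s) \<le> e t powr (- b)"
          using b by (simp add: field_simps)
        moreover have "b / c powr conj_exp p * (t / 2) \<le> b / c powr conj_exp p * (t - s)"
          using b t by (intro mult_left_mono) auto
        ultimately have "k * t \<le> e t powr (- b)"
          by (simp add: k_def)
        then have "(e t powr (- b)) powr (- (\<alpha> / b)) \<le> (k * t) powr (- (\<alpha> / b))"
          using k t b \<alpha> by (intro powr_mono2') auto
        then show ?thesis
          using b k t by (simp add: powr_powr powr_mult)
      next
        case False
        then have "e t = 0" using e_nonneg[of t] t by simp
        then show ?thesis by simp
      qed
      then have "c / \<alpha> * e t powr \<alpha> \<le> c / \<alpha> * (k powr (- (\<alpha> / b)) * t powr (- (\<alpha> / b)))"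
        using c \<alpha> by (intro mult_left_mono) auto
      then show ?case
        using H_nonneg[of t] unfolding exponent by (simp add: H_def C_def mult.assoc)
    qed
  qed
qed

text \<open>The function H powr \<eta> stays below the line that starts from its value at
  \<open>s\<close> with slope - \<eta> / A, and \<open>T\<close> is the zero of that line. Positive
  energy at \<open>t\<close> therefore forces t < T.\<close>

lemma energy_extinction:
  assumes s: "start s" "s \<le> t" and \<alpha>_gt: "1 / p < \<alpha>" and pos: "0 < e t"
  defines "T \<equiv> extinction_time p \<alpha> c s (e s)"
  shows "t < T" "H t \<le> decay_const p \<alpha> c * (T - t) powr (\<alpha> * (p - 1) / (p * \<alpha> - 1))"
proof -
  \<comment> \<open>Raising \<open>H\<close> to the power \<eta> = b / \<alpha> corresponds to
    raising \<open>e\<close> to the power b, and 1 / A is the constant in - H' \<ge> 1 / A * H powr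
    (1 - \<eta>).\<close>
  define \<eta> where "\<eta> = (p * \<alpha> - 1) / (\<alpha> * (p - 1))"
  define A where "A = \<alpha> powr ((\<alpha> - 1) / (\<alpha> * (p - 1))) * c powr (1 / (\<alpha> * (p - 1)))"
  define b where "b = 1 - (1 - \<alpha>) * conj_exp p"
  have p\<alpha>: "0 < p * \<alpha> - 1" using \<alpha>_gt p by (simp add: field_simps)
  have \<eta>: "0 < \<eta>" using p\<alpha> p \<alpha> by (simp add: \<eta>_def)
  have A: "0 < A" using c \<alpha> by (simp add: A_def)
  have b_eq: "b = \<alpha> * \<eta>"
    using p \<alpha> by (simp add: b_def \<eta>_def conj_exp_def field_simps)
  have b: "0 < b" using \<alpha> \<eta> by (simp add: b_eq)
  have es: "0 < e s" using pos e_antimono_start[OF s(1) _ s(2)] by simp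
  have H_\<eta>: "H r powr \<eta> = (c / \<alpha>) powr \<eta> * e r powr b" if "0 < e r" for r
    unfolding H_def using that c \<alpha> by (subst powr_mult) (simp_all add: powr_powr b_eq)
  have key: "(c / \<alpha>) powr \<eta> * (b / c powr conj_exp p) = \<eta> / A"
  proof -
    \<comment> \<open>Taking logarithms reduces the identity to comparing the exponents of c and of
      \<alpha>.\<close>
    have "ln ((c / \<alpha>) powr \<eta> * \<alpha> / c powr conj_exp p) = ln (1 / A)"
    proof -
      have "ln ((c / \<alpha>) powr \<eta> * \<alpha> / c powr conj_exp p) = \<eta> * (ln c - ln \<alpha>) + ln \<alpha> - conj_exp p * ln c"
        using c \<alpha> by (simp add: ln_mult ln_div ln_powr)
      also have "\<dots> = (\<eta> - conj_exp p) * ln c + (1 - \<eta>) * ln \<alpha>"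
        by (simp add: algebra_simps)
      also have "\<eta> - conj_exp p = - (1 / (\<alpha> * (p - 1)))"
      proof -
        have "conj_exp p = p * \<alpha> / (\<alpha> * (p - 1))"
          using \<alpha> by (simp add: conj_exp_def)
        then show ?thesis by (simp add: \<eta>_def diff_divide_distrib)
      qed
      also have "1 - \<eta> = - ((\<alpha> - 1) / (\<alpha> * (p - 1)))"
      proof -
        have "1 - \<eta> = (\<alpha> * (p - 1) - (p * \<alpha> - 1)) / (\<alpha> * (p - 1))"
          using p \<alpha> by (simp add: \<eta>_def diff_divide_distrib)
        also have "\<alpha> * (p - 1) - (p * \<alpha> - 1) = - (\<alpha> - 1)"
          by (simp add: algebra_simps)
        finally show ?thesis by (simp only: minus_divide_left)
      qed
      also have "- (1 / (\<alpha> * (p - 1))) * ln c + - ((\<alpha> - 1) / (\<alpha> * (p - 1))) * ln \<alpha> = ln (1 / A)"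
        using c \<alpha> by (simp add: A_def ln_mult ln_div ln_powr)
      finally show ?thesis .
    qed
    then have "(c / \<alpha>) powr \<eta> * \<alpha> / c powr conj_exp p = 1 / A"
      using c \<alpha> A by (subst (asm) ln_inj_iff) auto
    then show ?thesis
      by (simp add: b_eq) (metis (no_types, lifting) mult.commute mult.left_commute times_divide_eq_right mult.right_neutral)
  qed
  have T: "T - s = A / \<eta> * H s powr \<eta>"
    by (simp add: T_def extinction_time_def A_def \<eta>_def H_def)
  have "(t - s) / c powr conj_exp p \<le> (e s powr b - e t powr b) / b"
    unfolding b_def by (rule energy_separation_powr[OF s pos refl]) (use b in \<open>auto simp: b_def\<close>)
  then have "(t - s) * (b / c powr conj_exp p) \<le> e s powr b - e t powr b"
    using b by (simp add: field_simps)
  then have "(c / \<alpha>) powr \<eta> * ((t - s) * (b / c powr conj_exp p)) \<le> (c / \<alpha>) powr \<eta> * (e s powr b - e t powr b)"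
    by (intro mult_left_mono) auto
  also have "\<dots> = H s powr \<eta> - H t powr \<eta>"
    using es pos by (simp add: H_\<eta> right_diff_distrib)
  also have "(c / \<alpha>) powr \<eta> * ((t - s) * (b / c powr conj_exp p)) = (t - s) * (\<eta> / A)"
    unfolding key[symmetric] by (simp add: mult_ac)
  finally have le: "H t powr \<eta> \<le> H s powr \<eta> - (t - s) * (\<eta> / A)" by simp
  also have "\<dots> = \<eta> / A * (T - t)"
  proof -
    have "H s powr \<eta> = \<eta> / A * (T - s)"
      using A \<eta> by (simp add: T)
    moreover define k where "k = \<eta> / A"
    ultimately show ?thesis
      unfolding k_def[symmetric] by (simp add: algebra_simps)
  qed
  finally have H_le: "H t powr \<eta> \<le> \<eta> / A * (T - t)" .
  have H_pos: "0 < H t" using pos c \<alpha> by (simp add: H_def)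
  then have "0 < \<eta> / A * (T - t)"
    using H_le by (metis less_le_trans powr_gt_zero less_irrefl)
  moreover have "0 < \<eta> / A" using A \<eta> by simp
  ultimately have "0 < T - t" by (rule zero_less_mult_pos)
  then show "t < T" by simp
  have "(H t powr \<eta>) powr (1 / \<eta>) \<le> (\<eta> / A * (T - t)) powr (1 / \<eta>)"
    using H_le \<eta> by (intro powr_mono2) auto
  then have "H t \<le> (\<eta> / A) powr (1 / \<eta>) * (T - t) powr (1 / \<eta>)"
    using H_pos \<eta> A \<open>t < T\<close> by (subst (asm) powr_mult) (simp_all add: powr_powr)
  \<comment> \<open>The decay constant is the steepness of the line, raised to 1 / \<eta>.\<close>
  moreover have "(\<eta> / A) powr (1 / \<eta>) = decay_const p \<alpha> c"
  proof -
    have "(1 / (\<alpha> powr (\<alpha> - 1) * c)) powr ((conj_exp p - 1) / \<alpha>) = 1 / A"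
    proof -
      have "(conj_exp p - 1) / \<alpha> = 1 / (\<alpha> * (p - 1))"
        using p \<alpha> by (simp add: conj_exp_def field_simps)
      then show ?thesis
        using c \<alpha> by (simp add: A_def powr_divide powr_mult powr_powr)
    qed
    then show ?thesis
      by (simp add: decay_const_def \<eta>_def mult_ac)
  qed
  moreover have "1 / \<eta> = \<alpha> * (p - 1) / (p * \<alpha> - 1)"
    by (simp add: \<eta>_def)
  ultimately show "H t \<le> decay_const p \<alpha> c * (T - t) powr (\<alpha> * (p - 1) / (p * \<alpha> - 1))"
    by simp
qed

end

section \<open>The three regimes\<close>

theorem theorem3p24:
  fixes E :: "'a::complete_space \<Rightarrow> ereal"
    and g :: "'a \<Rightarrow> ennreal"
    and v :: "real \<Rightarrow> 'a"
    and \<phi> :: 'a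
    and p \<epsilon> c \<alpha> tbar :: real
  assumes "1 < p"
    and "proper_functional E"
    and "strong_upper_gradient E g"
    and "gradient_flow p E g v"
    and "omega_limit v \<noteq> {}"
    and "0 < tbar"
    and "lsc_on (closure (v ` {tbar..})) E"
    and "\<phi> \<in> omega_limit v"
    and "g \<phi> = 0"
    and "0 < \<epsilon>"
    and "0 < c"
    and "0 < \<alpha>" and "\<alpha> \<le> 1"
    and "LS_inequality E g \<phi> \<epsilon> c \<alpha>"
  shows "entry_times v \<phi> \<epsilon> \<noteq> {} \<and>
    (\<forall>t0 \<ge> first_entry_time v \<phi> \<epsilon>. (t0 = 0 \<longrightarrow> regular_at_zero E v) \<longrightarrow>
      (\<forall>t\<ge>t0. E \<phi> \<le> E (v t)) \<and>
      (\<alpha> < 1 / p \<longrightarrow>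
        (\<forall>t\<ge>t0. dist (v t) \<phi> \<le> c / \<alpha> * rel_energy E (v t) \<phi> powr \<alpha>) \<and>
        (\<lambda>t. c / \<alpha> * rel_energy E (v t) \<phi> powr \<alpha>)
          \<in> O[at_top](\<lambda>t. t powr (- (\<alpha> * (p - 1) / (1 - p * \<alpha>))))) \<and>
      (\<alpha> = 1 / p \<longrightarrow>
        (\<forall>t\<ge>t0.
          dist (v t) \<phi> \<le> c * p * rel_energy E (v t) \<phi> powr (1 / p) \<and>
          c * p * rel_energy E (v t) \<phi> powr (1 / p)
            \<le> c * p * rel_energy E (v t0) \<phi> powr (1 / p)
                * exp (- ((t - t0) / (p * c powr conj_exp p))))) \<and>
      (1 / p < \<alpha> \<longrightarrow>
        (let T = extinction_time p \<alpha> c t0 (rel_energy E (v t0) \<phi>) in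
          (\<forall>t. t0 \<le> t \<and> t \<le> T \<longrightarrow>
             dist (v t) \<phi>
               \<le> decay_const p \<alpha> c * (T - t) powr (\<alpha> * (p - 1) / (p * \<alpha> - 1))) \<and>
          (\<forall>t>T. dist (v t) \<phi> \<le> 0))))"
proof -
  have E_antimono: "E (v t) \<le> E (v s)" if "0 < s" "s \<le> t" for s t
    using assms(4) that unfolding gradient_flow_def by blast
  have "\<phi> \<in> {u. g u < \<infinity>}"
    using assms(9) by simp
  then have "\<phi> \<in> eff_domain E"
    using assms(3) unfolding strong_upper_gradient_def by blast
  then have "E \<phi> < \<infinity>"
    by (simp add: eff_domain_def)
  then interpret Lojasiewicz_flow E g v \<phi> p \<epsilon> c \<alpha>
    using assms energy_ge_limit[OF E_antimono assms(7,8)]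
    by unfold_locales (auto simp: proper_functional_def)
  have main: "(\<forall>t\<ge>t0. E \<phi> \<le> E (v t)) \<and>
      (\<alpha> < 1 / p \<longrightarrow> (\<forall>t\<ge>t0. dist (v t) \<phi> \<le> H t) \<and> H \<in> O(\<lambda>t. t powr (- (\<alpha> * (p - 1) / (1 - p * \<alpha>))))) \<and>
      (\<alpha> = 1 / p \<longrightarrow> (\<forall>t\<ge>t0. dist (v t) \<phi> \<le> c * p * e t powr (1 / p) \<and>
          c * p * e t powr (1 / p) \<le> c * p * e t0 powr (1 / p) * exp (- ((t - t0) / (p * c powr conj_exp p))))) \<and>
      (1 / p < \<alpha> \<longrightarrow> (let T = extinction_time p \<alpha> c t0 (e t0) in
          (\<forall>t. t0 \<le> t \<and> t \<le> T \<longrightarrow>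
             dist (v t) \<phi> \<le> decay_const p \<alpha> c * (T - t) powr (\<alpha> * (p - 1) / (p * \<alpha> - 1))) \<and>
          (\<forall>t>T. dist (v t) \<phi> \<le> 0)))"
    if t0: "start t0" for t0
  proof (intro conjI impI allI)
    fix t assume t: "t0 \<le> t"
    show "E \<phi> \<le> E (v t)" by (rule E_ge_start[OF t0 t])
    show "dist (v t) \<phi> \<le> H t" by (rule dist_limit_le_H[OF assms(8) t0 t])
    then show "dist (v t) \<phi> \<le> c * p * e t powr (1 / p)" if "\<alpha> = 1 / p"
      using that unfolding H_def by simp
    show "c * p * e t powr (1 / p) \<le> c * p * e t0 powr (1 / p) * exp (- ((t - t0) / (p * c powr conj_exp p)))"
      if "\<alpha> = 1 / p"
    proof -
      have "c * p * e t powr (1 / p) \<le> c * p * (e t0 powr (1 / p) * exp (- ((t - t0) / (p * c powr conj_exp p))))"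
        using p c by (intro mult_left_mono energy_exponential_decay[OF t0 t that]) auto
      then show ?thesis by (simp add: mult.assoc)
    qed
  next
    show "H \<in> O(\<lambda>t. t powr (- (\<alpha> * (p - 1) / (1 - p * \<alpha>))))" if "\<alpha> < 1 / p"
      by (rule energy_polynomial_decay[OF t0 that])
  next
    assume \<alpha>_gt: "1 / p < \<alpha>"
    let ?T = "extinction_time p \<alpha> c t0 (e t0)"
    have H_0: "H t = 0" if "t0 \<le> t" "\<not> 0 < e t" for t
      using that E_fin_start[OF t0 that(1)] E_ge_start[OF t0 that(1)] e_nonneg_iff[of t]
      by (simp add: H_def)
    have "dist (v t) \<phi> \<le> decay_const p \<alpha> c * (?T - t) powr (\<alpha> * (p - 1) / (p * \<alpha> - 1))"
      if "t0 \<le> t" for t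
    \<comment> \<open>The curve may reach \<open>\<phi>\<close> before \<open>?T\<close>; from then
      on the bound holds because its right-hand side is nonnegative.\<close>
    proof (cases "0 < e t")
      case True
      with energy_extinction(2)[OF t0 that \<alpha>_gt] dist_limit_le_H[OF assms(8) t0 that] show ?thesis by simp
    next
      case False
      with H_0[OF that] dist_limit_le_H[OF assms(8) t0 that]
      have "dist (v t) \<phi> \<le> 0" by simp
      also have "0 \<le> decay_const p \<alpha> c * (?T - t) powr (\<alpha> * (p - 1) / (p * \<alpha> - 1))"
        by (simp add: decay_const_def)
      finally show ?thesis .
    qed
    moreover have "dist (v t) \<phi> \<le> 0" if "?T < t" for t
    proof -
      \<comment> \<open>This ensures that every time beyond \<open>?T\<close> is also beyond
        \<open>t0\<close>, where the estimates are valid.\<close>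
      have "t0 \<le> ?T"
      proof -
        have "0 \<le> p * \<alpha> - 1"
          using p \<alpha>_gt by (simp add: field_simps)
        then show ?thesis
          using p \<alpha> unfolding extinction_time_def
          by (intro le_add_same_cancel1[THEN iffD2] mult_nonneg_nonneg divide_nonneg_nonneg) auto
      qed
      with that have t: "t0 \<le> t" by simp
      have "\<not> 0 < e t"
        using energy_extinction(1)[OF t0 t \<alpha>_gt] that by auto
      with H_0[OF t] dist_limit_le_H[OF assms(8) t0 t] show ?thesis by simp
    qed
    ultimately show "let T = ?T in
        (\<forall>t. t0 \<le> t \<and> t \<le> T \<longrightarrow>
           dist (v t) \<phi> \<le> decay_const p \<alpha> c * (T - t) powr (\<alpha> * (p - 1) / (p * \<alpha> - 1))) \<and>
        (\<forall>t>T. dist (v t) \<phi> \<le> 0)"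
      by (simp add: Let_def)
  qed
  show ?thesis
    using entry_times_nonempty[OF assms(8)] main start_first_entry_time[OF assms(8)]
    unfolding H_def[abs_def] e_def by blast
qed

end
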